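(* In the concrete model with a right-end simplicial mode $\chi$ ($\chi^2=\mathbb{1}$), let $S:=\lfloor (M+2)/3\rfloor$ and suppose $P_M(z)$ has $S$ pairwise distinct roots $z_1,\dots,z_S$ (necessarily nonzero since $P_M(0)=1$) and that $P_{M-r_M}(z_k)\neq0$ for all $k$, where $r_M=1$ for odd $M$ and $r_M=2$ for even $M$. Choose $u_k$ with $u_k^2=z_k$, set $u_{-k}:=-u_k$, $\epsilon_k:=u_k^{-1}$, and $$\Psi_k:=\frac{T_M(-u_k)\,\chi\,T_M(u_k)}{\mathcal{N}_k},\qquad \mathcal{N}_k=\mathcal{N}_{-k}:=4\sqrt{P_{M-r_M}(u_k^2)\,\big(-u_k^2P_M'(u_k^2)\big)}$$ (any fixed branch of the square root), for $k=\pm1,\dots,\pm S$, where $P_M'$ is the derivative in $z$. Then $[H_M,\Psi_k]=2\epsilon_k\Psi_k$ and $\{\Psi_k,\Psi_{k'}\}=\delta_{k+k',0}\,\mathbb{1}$ for all $k,k'\in\{\pm1,\dots,\pm S\}$.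
   Context: Concrete model. Fix an integer $M\ge1$ and complex numbers $b_1,\dots,b_M$. Let $h_1,\dots,h_M$ be elements of a unital associative complex algebra satisfying $h_m^2=b_m^2\mathbb{1}$, $h_mh_{m+1}=-h_{m+1}h_m$, $h_mh_{m+2}=-h_{m+2}h_m$, and $h_mh_l=h_lh_m$ for $|l-m|>2$ (e.g. $h_m=b_m\sigma^z_m\sigma^z_{m+1}\sigma^x_{m+2}$ on a spin chain). Set $h_j:=0$, $b_j:=0$ for $j\le 0$ or $j>M$. Let $\beta_3,\beta_5$ be arbitrary complex numbers and define $\beta_{2m+1}:=\beta_{2m-1}/(b_{2m-4}^2\beta_{2m-3}-b_{2m}^2\beta_{2m-1}+1)$ for $m\ge3$ (denominators assumed nonzero). For $2\le m\le\lfloor M/2\rfloor$ put $\bar h_{2m+1}:=\beta_{2m-1}h_{2m-2}h_{2m-3}h_{2m}$ and $\bar b_{2m+1}:=\beta_{2m-1}b_{2m-2}b_{2m-3}b_{2m}$ (so $\bar h_{2m+1}^2=\bar b_{2m+1}^2\mathbb{1}$); otherwise $\bar h_{2m+1}:=0$, $\bar b_{2m+1}:=0$. For $1\le j\le M$, the model of size $j$ (same couplings) has frustration graph $G_j$ with vertices $h_1,\dots,h_j$ and $\bar h_{2m+1}$ for $2\le m\le\lfloor j/2\rfloor$, and edges $h_i\sim h_l$ iff $|i-l|\in\{1,2\}$; $\bar h_{2m-1}\sim h_l$ iff $l\in\{2m-7,2m-5,2m-3,2m-1,2m-2,2m\}$; $\bar h_{2m-1}\sim\bar h_{2m'-1}$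 iff $|m-m'|=1$ (adjacent vertices anticommute, non-adjacent distinct ones commute). Charges: $Q_j^{(k)}:=\sum_{S}\prod_{v\in S}v$, the sum over independent sets $S$ of $G_j$ of size $k$ ($Q_j^{(0)}=\mathbb{1}$). Hamiltonian $H_j:=Q_j^{(1)}=\sum_{l=1}^j h_l+\sum_{m=2}^{\lfloor j/2\rfloor}\beta_{2m-1}h_{2m-2}h_{2m-3}h_{2m}$. Transfer matrix $T_j(u):=\sum_{k\ge0}(-u)^kQ_j^{(k)}$ for $u\in\mathbb{C}$, with $T_j(u):=\mathbb{1}$ for $j\le 0$. It is known that $T_j(u)T_j(-u)=P_j(u^2)\mathbb{1}$ for a scalar polynomial $P_j\in\mathbb{C}[z]$ (with $P_j:=1$ for $j\le0$). Right-end simplicial mode: an element $\chi$ of the ambient algebra such that, if $M$ is even, $\chi$ anticommutes with $h_M$ and $h_{M-1}$ and commutes with $h_l$ for $l<M-1$, and the simplicial clique is $K_M=\{h_{M-1},h_M,\bar h_{M+1}\}$; if $M$ is odd, $\chi$ anticommutes with $h_M$ and commutes with $h_l$ for $l<M$, and $K_M=\{h_M\}$. *)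

theory Defs
  imports "HOL-Computational_Algebra.Polynomial" "HOL-Library.Product_Lexorder"
begin

text \<open>A unital associative complex algebra is rendered as a ring_1 together with a
unital ring homomorphism c from the complex numbers into its centre; scalar
multiplication by lambda is c lambda times x.\<close>
definition cemb :: "(complex \<Rightarrow> 'a::ring_1) \<Rightarrow> bool" where
  "cemb c \<longleftrightarrow> (\<forall>x y. c (x + y) = c x + c y) \<and> (\<forall>x y. c (x * y) = c x * c y)
      \<and> c 1 = 1 \<and> (\<forall>x a. c x * a = a * c x)"

definition hx :: "nat \<Rightarrow> (nat \<Rightarrow> 'a::zero) \<Rightarrow> int \<Rightarrow> 'a" where
  "hx M h j = (if 1 \<le> j \<and> j \<le> int M then h (nat j) else 0)"

text \<open>betaf bb b3 b5 m is beta_(2m+1); bb is the zero-extended coupling b.\<close>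
fun betaf :: "(int \<Rightarrow> complex) \<Rightarrow> complex \<Rightarrow> complex \<Rightarrow> nat \<Rightarrow> complex" where
  "betaf bb b3 b5 0 = 0"
| "betaf bb b3 b5 (Suc 0) = b3"
| "betaf bb b3 b5 (Suc (Suc 0)) = b5"
| "betaf bb b3 b5 (Suc (Suc (Suc n))) =
     betaf bb b3 b5 (Suc (Suc n)) /
     ((bb (2 * int n + 2))\<^sup>2 * betaf bb b3 b5 (Suc n)
        - (bb (2 * int n + 6))\<^sup>2 * betaf bb b3 b5 (Suc (Suc n)) + 1)"

definition betaden :: "(int \<Rightarrow> complex) \<Rightarrow> complex \<Rightarrow> complex \<Rightarrow> nat \<Rightarrow> complex" where
  "betaden bb b3 b5 n = (bb (2 * int n + 2))\<^sup>2 * betaf bb b3 b5 (Suc n)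
        - (bb (2 * int n + 6))\<^sup>2 * betaf bb b3 b5 (Suc (Suc n)) + 1"

text \<open>Vertices: (l, False) is h_l, (p, True) is hbar_p.\<close>
definition Vset :: "nat \<Rightarrow> (int \<times> bool) set" where
  "Vset j = {(l, False) | l. 1 \<le> l \<and> l \<le> int j}
          \<union> {(2 * m + 1, True) | m. 2 \<le> m \<and> m \<le> int j div 2}"

fun adj :: "int \<times> bool \<Rightarrow> int \<times> bool \<Rightarrow> bool" where
  "adj (i, False) (l, False) = (\<bar>i - l\<bar> \<in> {1, 2})"
| "adj (p, True) (l, False) = (l \<in> {p - 6, p - 4, p - 2, p, p - 1, p + 1})"
| "adj (l, False) (p, True) = (l \<in> {p - 6, p - 4, p - 2, p, p - 1, p + 1})"
| "adj (p, True) (q, True) = (\<bar>p - q\<bar> = 2)"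

definition indep :: "(int \<times> bool) set \<Rightarrow> bool" where
  "indep S \<longleftrightarrow> (\<forall>v\<in>S. \<forall>w\<in>S. \<not> adj v w)"

text \<open>Value of a vertex: h_l, resp. hbar_(2m+1) = beta_(2m-1) h_(2m-2) h_(2m-3) h_(2m).\<close>
fun vval :: "(complex \<Rightarrow> 'a::ring_1) \<Rightarrow> nat \<Rightarrow> (nat \<Rightarrow> 'a) \<Rightarrow> (nat \<Rightarrow> complex)
    \<Rightarrow> complex \<Rightarrow> complex \<Rightarrow> int \<times> bool \<Rightarrow> 'a" where
  "vval c M h b b3 b5 (l, False) = hx M h l"
| "vval c M h b b3 b5 (p, True) =
     c (betaf (hx M b) b3 b5 (nat ((p - 3) div 2))) * hx M h (p - 3) * hx M h (p - 4) * hx M h (p - 1)"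

text \<open>Product over a set of (mutually commuting) elements, in a fixed order.\<close>
definition oprod :: "(int \<times> bool \<Rightarrow> 'a::monoid_mult) \<Rightarrow> (int \<times> bool) set \<Rightarrow> 'a" where
  "oprod f S = prod_list (map f (sorted_list_of_set S))"

definition Qch :: "(complex \<Rightarrow> 'a::ring_1) \<Rightarrow> nat \<Rightarrow> (nat \<Rightarrow> 'a) \<Rightarrow> (nat \<Rightarrow> complex)
    \<Rightarrow> complex \<Rightarrow> complex \<Rightarrow> nat \<Rightarrow> nat \<Rightarrow> 'a" where
  "Qch c M h b b3 b5 j k =
     (\<Sum>S\<in>{S. S \<subseteq> Vset j \<and> indep S \<and> card S = k}. oprod (vval c M h b b3 b5) S)"

definition Tm :: "(complex \<Rightarrow> 'a::ring_1) \<Rightarrow> nat \<Rightarrow> (nat \<Rightarrow> 'a) \<Rightarrow> (nat \<Rightarrow> complex)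
    \<Rightarrow> complex \<Rightarrow> complex \<Rightarrow> nat \<Rightarrow> complex \<Rightarrow> 'a" where
  "Tm c M h b b3 b5 j v = (\<Sum>k\<le>card (Vset j). c ((- v) ^ k) * Qch c M h b b3 b5 j k)"

definition us :: "(nat \<Rightarrow> complex) \<Rightarrow> int \<Rightarrow> complex" where
  "us u k = (if k > 0 then u (nat k) else - u (nat (- k)))"

definition Psi :: "(complex \<Rightarrow> 'a::ring_1) \<Rightarrow> nat \<Rightarrow> (nat \<Rightarrow> 'a) \<Rightarrow> (nat \<Rightarrow> complex)
    \<Rightarrow> complex \<Rightarrow> complex \<Rightarrow> 'a \<Rightarrow> (nat \<Rightarrow> complex) \<Rightarrow> (nat \<Rightarrow> complex) \<Rightarrow> int \<Rightarrow> 'a" where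
  "Psi c M h b b3 b5 chi u N k =
     c (1 / N (nat \<bar>k\<bar>)) * (Tm c M h b b3 b5 M (- us u k) * chi * Tm c M h b b3 b5 M (us u k))"

end

theory Submission
  imports Defs
begin

text \<open>Write T for the transfer matrix, H for the Hamiltonian and A for the transfer matrix of the
  model with the last clique K removed. Every neighbourhood of an element of K in the smaller graph is
  a clique, whence 2 T(u) = 2 A(u) - u {A(u), k} with k the sum of K, and k squares to a scalar.
  Call x intertwined if T(u) (x + u/2 [H, x]) = (x - u/2 [H, x]) T(u). An element that commutes with A
  and anticommutes with k is intertwined. The sum k itself is intertwined for the smaller model: for
  even size this is a finite computation with five generators, in which the recursion for the
  couplings enters exactly once. By induction this gives [H, T(u)] = 0.

  For C(v) = T(-v) chi T(v) the intertwining relation becomes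
  2 C(v) - v [H, C(v)] = P(v^2) (2 chi + v [H, chi]), so C(u) is an eigenvector of ad H when
  P(u^2) = 0. Taking the anticommutator with C(u), for which {C(u), chi} is a scalar, yields a
  recursion that forces the coefficients of the polynomial v -> {C(u), C(v)} to be scalars. The
  resulting identity of scalar polynomials gives the values at the roots v of P(v^2); the value at
  v = -u is a derivative, which is where P' comes from. The commutativity of the T(u) among themselves
  is never used.\<close>

section \<open>Central scalars\<close>

locale central_scalars =
  fixes c :: "complex \<Rightarrow> 'a::ring_1"
  assumes cemb: "cemb c"
begin

lemma c_add: "c (x + y) = c x + c y"
  and c_mult: "c (x * y) = c x * c y"
  and c_1 [simp]: "c 1 = 1"
  and c_comm: "c x * r = r * c x"
  using cemb unfolding cemb_def by blast+

lemma c_0 [simp]: "c 0 = 0"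
  by (metis add_0 add_cancel_left_left c_add)

lemma c_minus: "c (- x) = - c x"
  by (metis add.left_inverse c_0 c_add eq_neg_iff_add_eq_0)

lemma c_diff: "c (x - y) = c x - c y"
  by (metis c_add c_minus diff_conv_add_uminus)

lemma c_sum: "c (sum f A) = (\<Sum>x\<in>A. c (f x))"
  by (induction A rule: infinite_finite_induct) (auto simp: c_add)

lemma c_2: "c 2 = 2"
  by (metis c_1 c_add one_add_one)

lemma c_mult_cancel:
  assumes "c x * y = c x * z" "x \<noteq> 0"
  shows "y = z"
proof -
  have "c (inverse x) * (c x * y) = c (inverse x) * (c x * z)"
    using assms by simp
  then show ?thesis
    using assms(2) by (simp add: mult.assoc[symmetric] c_mult[symmetric])
qed

lemma c_eq_iff: "c x = c y \<longleftrightarrow> x = y"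
proof
  assume *: "c x = c y"
  show "x = y"
  proof (rule ccontr)
    assume "x \<noteq> y"
    moreover have "c (x - y) * 1 = c (x - y) * 0"
      using * by (simp add: c_diff)
    ultimately show False
      using c_mult_cancel[of "x - y" 1 0] by simp
  qed
qed auto

lemma c_left_comm: "y * (c x * w) = c x * (y * w)"
  by (metis c_comm mult.assoc)

lemma two_mult_cancel:
  fixes x y :: 'a
  assumes "2 * x = 2 * y"
  shows "x = y"
  using assms c_mult_cancel[of 2 x y] by (simp add: c_2)


subsection \<open>Polynomial functions of the spectral parameter\<close>

text \<open>The coefficients \<open>g n\<close> lie in the noncommutative algebra, while the powers
  of \<open>v\<close> are central; \<open>d\<close> is only an upper bound for the degree.\<close>

definition poly_fun :: "nat \<Rightarrow> (complex \<Rightarrow> 'a) \<Rightarrow> bool" where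
  "poly_fun d F \<longleftrightarrow> (\<exists>g. \<forall>v. F v = (\<Sum>n\<le>d. c (v ^ n) * g n))"

lemma poly_funI:
  assumes "\<And>v. F v = (\<Sum>n\<le>d. c (v ^ n) * g n)"
  shows "poly_fun d F"
  unfolding poly_fun_def using assms by (intro exI[of _ g]) simp

lemma poly_fun_mono:
  assumes "poly_fun d F" "d \<le> e"
  shows "poly_fun e F"
proof -
  obtain g where g: "F v = (\<Sum>n\<le>d. c (v ^ n) * g n)" for v
    using assms(1) by (auto simp: poly_fun_def)
  have "F v = (\<Sum>n\<le>e. c (v ^ n) * (if n \<le> d then g n else 0))" for v
    unfolding g using assms(2) by (intro sum.mono_neutral_cong_left) auto
  then show ?thesis
    by (rule poly_funI)
qed

lemma poly_fun_const: "poly_fun d (\<lambda>_. x)"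
proof -
  have "poly_fun 0 (\<lambda>_. x)"
    unfolding poly_fun_def by (rule exI[of _ "\<lambda>_. x"]) simp
  then show ?thesis
    by (rule poly_fun_mono) simp
qed

lemma poly_fun_add:
  assumes "poly_fun d F" "poly_fun d G"
  shows "poly_fun d (\<lambda>v. F v + G v)"
proof -
  obtain f g where "F v = (\<Sum>n\<le>d. c (v ^ n) * f n)" "G v = (\<Sum>n\<le>d. c (v ^ n) * g n)" for v
    using assms by (auto simp: poly_fun_def)
  then show ?thesis
    unfolding poly_fun_def by (intro exI[of _ "\<lambda>n. f n + g n"]) (simp add: distrib_left sum.distrib)
qed

lemma poly_fun_mult_left:
  assumes "poly_fun d F"
  shows "poly_fun d (\<lambda>v. x * F v)"
proof -
  obtain f where "F v = (\<Sum>n\<le>d. c (v ^ n) * f n)" for v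
    using assms by (auto simp: poly_fun_def)
  then show ?thesis
    unfolding poly_fun_def
    by (intro exI[of _ "\<lambda>n. x * f n"]) (simp add: sum_distrib_left c_left_comm[of x])
qed

lemma poly_fun_mult_right:
  assumes "poly_fun d F"
  shows "poly_fun d (\<lambda>v. F v * x)"
proof -
  obtain f where "F v = (\<Sum>n\<le>d. c (v ^ n) * f n)" for v
    using assms by (auto simp: poly_fun_def)
  then show ?thesis
    unfolding poly_fun_def
    by (intro exI[of _ "\<lambda>n. f n * x"]) (simp add: sum_distrib_right mult.assoc)
qed

lemma poly_fun_diff:
  assumes "poly_fun d F" "poly_fun d G"
  shows "poly_fun d (\<lambda>v. F v - G v)"
  using poly_fun_add[OF assms(1) poly_fun_mult_left[OF assms(2), of "-1"]] by simp

lemma poly_fun_scale: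
  assumes "poly_fun d F"
  shows "poly_fun (Suc d) (\<lambda>v. c v * F v)"
proof -
  obtain f where f: "F v = (\<Sum>n\<le>d. c (v ^ n) * f n)" for v
    using assms by (auto simp: poly_fun_def)
  have "c v * F v = (\<Sum>n\<le>Suc d. c (v ^ n) * (case n of 0 \<Rightarrow> 0 | Suc n \<Rightarrow> f n))" for v
    unfolding f sum.atMost_Suc_shift by (simp add: sum_distrib_left c_mult mult.assoc)
  then show ?thesis
    by (rule poly_funI)
qed

lemma poly_fun_uminus:
  assumes "poly_fun d F"
  shows "poly_fun d (\<lambda>v. F (- v))"
proof -
  obtain f where f: "F v = (\<Sum>n\<le>d. c (v ^ n) * f n)" for v
    using assms by (auto simp: poly_fun_def)
  have "F (- v) = (\<Sum>n\<le>d. c (v ^ n) * (c ((-1) ^ n) * f n))" for v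
    unfolding f by (intro sum.cong) (simp_all add: power_minus[of v] c_mult c_left_comm[of "c _"] mult.assoc)
  then show ?thesis
    by (rule poly_funI)
qed

text \<open>Only \<open>G\<close> is expanded: each of its coefficients multiplies \<open>F\<close>
  from the right, and the central power of \<open>v\<close> raises the degree by
  \<open>n\<close>.\<close>

lemma poly_fun_mult:
  assumes "poly_fun d F" "poly_fun e G"
  shows "poly_fun (d + e) (\<lambda>v. F v * G v)"
proof -
  obtain g where g: "G v = (\<Sum>n\<le>e. c (v ^ n) * g n)" for v
    using assms(2) by (auto simp: poly_fun_def)
  have pow: "poly_fun (d + n) (\<lambda>v. c (v ^ n) * (F v * x))" for n x
  proof (induction n)
    case (Suc n)
    from poly_fun_scale[OF this] show ?case
      by (simp add: c_mult mult.assoc)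
  qed (simp add: assms(1) poly_fun_mult_right)
  have "poly_fun (d + e) (\<lambda>v. \<Sum>n\<le>k. c (v ^ n) * (F v * g n))" if "k \<le> e" for k
    using that
  proof (induction k)
    case 0
    then show ?case
      using poly_fun_mono[OF pow[of 0]] by simp
  next
    case (Suc k)
    then show ?case
      using poly_fun_add[OF Suc.IH poly_fun_mono[OF pow[of "Suc k"]]] by simp
  qed
  from this[of e] show ?thesis
    unfolding g by (simp add: sum_distrib_left c_left_comm[of "F _"])
qed

lemma c_poly:
  assumes "degree p \<le> d"
  shows "c (poly p v) = (\<Sum>n\<le>d. c (v ^ n) * c (coeff p n))"
proof -
  have "poly p v = (\<Sum>n\<le>d. v ^ n * coeff p n)"
    unfolding poly_altdef using assms
    by (intro sum.mono_neutral_cong_left) (auto simp: coeff_eq_0)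
  then show ?thesis
    by (simp add: c_sum c_mult)
qed

text \<open>Subtracting 2^(d+1) times the relation at v from the relation at 2v removes the top
  coefficient and multiplies the others by the nonzero numbers 2^n - 2^(d+1), which gives an
  induction on the degree bound.\<close>

lemma coeffs_zero:
  assumes "\<And>v. (\<Sum>n\<le>d. c (v ^ n) * g n) = 0" "n \<le> d"
  shows "g n = 0"
  using assms
proof (induction d arbitrary: g n)
  case 0
  from "0.prems"(1)[of 1] "0.prems"(2) show ?case by simp
next
  case (Suc d)
  have "g n = 0" if "n \<le> d" for n
  proof -
    have "(\<Sum>n\<le>d. c (v ^ n) * (c (2 ^ n - 2 ^ Suc d) * g n)) = 0" for v
    proof -
      have "0 = (\<Sum>n\<le>Suc d. c ((2 * v) ^ n) * g n) - c (2 ^ Suc d) * (\<Sum>n\<le>Suc d. c (v ^ n) * g n)"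
        by (simp only: Suc.prems(1)) simp
      also have "\<dots> = (\<Sum>n\<le>Suc d. c (v ^ n) * (c (2 ^ n - 2 ^ Suc d) * g n))"
        unfolding sum_distrib_left sum_subtractf[symmetric]
      proof (intro sum.cong refl)
        fix n
        have "(2 * v) ^ n = v ^ n * 2 ^ n"
          by (simp add: power_mult_distrib)
        then show "c ((2 * v) ^ n) * g n - c (2 ^ Suc d) * (c (v ^ n) * g n)
            = c (v ^ n) * (c (2 ^ n - 2 ^ Suc d) * g n)"
          by (simp only: c_mult c_diff left_diff_distrib right_diff_distrib mult.assoc
            c_left_comm[of "c (2 ^ Suc d)" "v ^ n"])
      qed
      finally show ?thesis by simp
    qed
    from Suc.IH[OF this that] have "c (2 ^ n - 2 ^ Suc d) * g n = c (2 ^ n - 2 ^ Suc d) * 0"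
      by simp
    moreover have "(2 :: complex) ^ n - 2 ^ Suc d \<noteq> 0"
    proof -
      have "(2::nat) ^ n \<noteq> 2 ^ Suc d" using that by (simp only: power_inject_exp)
      then show ?thesis
        by (metis eq_iff_diff_eq_0 of_nat_eq_iff of_nat_numeral of_nat_power)
    qed
    ultimately show ?thesis
      by (rule c_mult_cancel)
  qed
  moreover from this Suc.prems(1)[of 1] have "g (Suc d) = 0"
    by simp
  ultimately show ?case
    using Suc.prems(2) le_Suc_eq by blast
qed

text \<open>If the degree exceeded \<open>d\<close>, comparing coefficients would make the leading
  coefficient zero.\<close>

lemma degree_le_of_poly_fun:
  assumes "poly_fun d (\<lambda>v. c (poly p v))"
  shows "degree p \<le> d"
proof (rule ccontr)
  assume "\<not> degree p \<le> d"
  then have le: "d \<le> degree p" and lt: "d < degree p" by auto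
  obtain g where g: "c (poly p v) = (\<Sum>n\<le>d. c (v ^ n) * g n)" for v
    using assms by (auto simp: poly_fun_def)
  have "(\<Sum>n\<le>degree p. c (v ^ n) * (c (coeff p n) - (if n \<le> d then g n else 0))) = 0" for v
  proof -
    have "(\<Sum>n\<le>degree p. c (v ^ n) * c (coeff p n)) = c (poly p v)"
      by (rule c_poly[symmetric]) simp
    moreover have "(\<Sum>n\<le>degree p. c (v ^ n) * (if n \<le> d then g n else 0)) = c (poly p v)"
      unfolding g using le by (intro sum.mono_neutral_cong_right) auto
    ultimately show ?thesis
      by (simp add: right_diff_distrib sum_subtractf)
  qed
  from coeffs_zero[OF this, of "degree p"] lt have "c (lead_coeff p) = c 0"
    by simp
  then have "lead_coeff p = 0"
    unfolding c_eq_iff .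
  with lt show False
    by simp
qed

text \<open>The coefficients of G are determined recursively, each from the previous one, so they are
  scalars.\<close>
lemma scalar_solution:
  assumes G: "poly_fun d G"
    and eq: "\<And>v. c 2 * G v + c v * (c r * G v - (H * G v - G v * H)) = c (poly p v)"
  shows "\<exists>q. \<forall>v. G v = c (poly q v)"
proof -
  obtain g0 where g0: "G v = (\<Sum>n\<le>d. c (v ^ n) * g0 n)" for v
    using G by (auto simp: poly_fun_def)
  \<comment> \<open>Extension by zero makes the coefficient at \<open>Suc m\<close> available, as
    multiplication by \<open>c v\<close> raises the degree by one.\<close>
  define g where "g n = (if n \<le> d then g0 n else 0)" for n
  define L where "L x = c r * x - (H * x - x * H)" for x
  \<comment> \<open>\<open>k n\<close> is the coefficient of v^n in the difference of the two sides
    of \<open>eq\<close>, so all \<open>k n\<close> vanish.\<close>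
  define k where "k n = c 2 * g n + (case n of 0 \<Rightarrow> 0 | Suc n \<Rightarrow> L (g n)) - c (coeff p n)" for n
  define m where "m = max d (degree p)"
  have Gm: "G v = (\<Sum>n\<le>m. c (v ^ n) * g n)" for v
    unfolding g0 m_def g_def by (intro sum.mono_neutral_cong_left) auto
  have "L (c w * x) = c w * L x" for w x
    unfolding L_def by (simp add: right_diff_distrib mult.assoc c_left_comm[of H] c_left_comm[of "c r"])
  moreover have "L (sum f A) = (\<Sum>n\<in>A. L (f n))" for f and A :: "nat set"
    unfolding L_def by (simp add: sum_distrib_left sum_distrib_right sum_subtractf)
  ultimately have LG: "L (G v) = (\<Sum>n\<le>m. c (v ^ n) * L (g n))" for v
    unfolding Gm by simp
  have "(\<Sum>n\<le>Suc m. c (v ^ n) * k n) = 0" for v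
  proof -
    have 1: "(\<Sum>n\<le>Suc m. c (v ^ n) * (c 2 * g n)) = c 2 * G v"
    proof -
      have "g (Suc m) = 0" by (auto simp: g_def m_def)
      then show ?thesis
        unfolding Gm by (simp add: sum_distrib_left c_left_comm[of "c 2"])
    qed
    have 2: "(\<Sum>n\<le>Suc m. c (v ^ n) * (case n of 0 \<Rightarrow> 0 | Suc n \<Rightarrow> L (g n))) = c v * L (G v)"
      unfolding LG sum.atMost_Suc_shift by (simp add: sum_distrib_left c_mult mult.assoc)
    have 3: "(\<Sum>n\<le>Suc m. c (v ^ n) * c (coeff p n)) = c (poly p v)"
      by (rule c_poly[symmetric]) (simp add: m_def)
    show ?thesis
      unfolding k_def right_diff_distrib distrib_left sum_subtractf sum.distrib 1 2 3
      using eq[of v] by (simp add: L_def)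
  qed
  from coeffs_zero[OF this] have k0: "k n = 0" if "n \<le> Suc m" for n
    using that .
  have half: "c (1/2) * (c 2 * x) = x" for x
    by (simp add: mult.assoc[symmetric] c_mult[symmetric])
  have scalar: "\<exists>a. g n = c a" if "n \<le> Suc m" for n
    using that
  proof (induction n)
    case 0
    have "c 2 * g 0 = c (coeff p 0)"
      using k0[of 0] by (simp add: k_def)
    then show ?case
      by (metis half c_mult)
  next
    case (Suc n)
    then obtain a where a: "g n = c a" by auto
    have "c 2 * g (Suc n) = c (coeff p (Suc n)) - L (c a)"
      using k0[OF Suc.prems] by (simp add: k_def a algebra_simps)
    \<comment> \<open>The commutator with \<open>H\<close> vanishes on scalars, so \<open>L\<close>
      maps the scalar \<open>a\<close> to \<open>r * a\<close>.\<close>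
    also have "\<dots> = c (coeff p (Suc n) - r * a)"
      by (simp add: L_def c_diff c_mult c_comm[of a H])
    finally show ?case
      by (metis half c_mult)
  qed
  then obtain a where a: "g n = c (a n)" if "n \<le> Suc m" for n
    by metis
  have "G v = c (poly (\<Sum>n\<le>m. monom (a n) n) v)" for v
    unfolding Gm by (simp add: poly_sum poly_monom c_sum c_mult a c_comm[of "a _"])
  then show ?thesis
    by blast
qed

end


section \<open>The local intertwining relation\<close>

text \<open>In the chain, a, d, e, f, n are h (j - 2), h (j - 3), h j, h (j - 1), h (j + 2), and p, q are the
  coefficients of hb (j + 1), hb (j + 3). Then Y = h (j + 2) + hb (j + 3), and W is half of [H, Y].\<close>
locale cluster =
  fixes u p q g sa sd se sf a d e f n :: "'a::ring_1"
  assumes central: "u * x = x * u" "p * x = x * p" "q * x = x * q" "g * x = x * g"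
      "sa * x = x * sa" "sd * x = x * sd" "se * x = x * se" "sf * x = x * sf"
    and sq: "a * a = sa" "d * d = sd" "e * e = se" "f * f = sf"
    and swap: "n * a = a * n" "e * d = d * e" "n * d = d * n" "n * f = f * n"
      "d * a = - (a * d)" "e * a = - (a * e)" "f * a = - (a * f)" "f * d = - (d * f)"
      "f * e = - (e * f)" "n * e = - (e * n)"
begin

definition Y :: 'a where
  "Y = n + q * e * f * n"

definition W :: 'a where
  "W = (e + p * a * d * e + q * d * e * f - q * sf * e + q * p * se * a * d * f) * n"

lemma lift: "x * y = z * v \<Longrightarrow> x * (y * w) = z * (v * w)" for x y z v w :: 'a
  by (metis mult.assoc)

lemma lift_minus: "x * y = - (z * v) \<Longrightarrow> x * (y * w) = - (z * (v * w))" for x y z v w :: 'a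
  by (metis mult.assoc mult_minus_left)

lemma lift_sq: "x * y = z \<Longrightarrow> x * (y * w) = z * w" for x y z w :: 'a
  by (metis mult.assoc)

text \<open>Oriented rewrite rules: words are sorted into the order \<open>a\<close>,
  \<open>d\<close>, \<open>e\<close>, \<open>f\<close>, \<open>n\<close> and squares are contracted
  to scalars. The lifted forms act inside right-nested products.\<close>

lemmas swaps = swap swap(1-4)[THEN lift] swap(5-10)[THEN lift_minus] sq sq[THEN lift_sq]

lemma scalar_swap:
  "x * u = u * x" "x * (u * w) = u * (x * w)" "x * p = p * x" "x * (p * w) = p * (x * w)"
  "x * q = q * x" "x * (q * w) = q * (x * w)" "x * g = g * x" "x * (g * w) = g * (x * w)"
  "x * sa = sa * x" "x * (sa * w) = sa * (x * w)" "x * sd = sd * x" "x * (sd * w) = sd * (x * w)"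
  "x * se = se * x" "x * (se * w) = se * (x * w)" "x * sf = sf * x" "x * (sf * w) = sf * (x * w)"
  by (metis central mult.assoc)+

text \<open>Scalars move to the front and are sorted as \<open>sf\<close>, \<open>se\<close>,
  \<open>sd\<close>, \<open>sa\<close>, \<open>g\<close>, \<open>q\<close>, \<open>p\<close>,
  \<open>u\<close>; dropping initial rules for the later instances keeps the rewriting from
  looping.\<close>

lemmas scalar_swaps = scalar_swap[of a] scalar_swap[of d] scalar_swap[of e] scalar_swap[of f]
  scalar_swap[of n] scalar_swap(3-)[of u] scalar_swap(5-)[of p] scalar_swap(7-)[of q]
  scalar_swap(9-)[of g] scalar_swap(11-)[of sa] scalar_swap(13-)[of sd] scalar_swap(15-)[of se]

lemmas normalize = distrib_left distrib_right left_diff_distrib right_diff_distrib mult.assoc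
  mult_minus_left mult_minus_right mult_1_left mult_1_right minus_minus swaps scalar_swaps

text \<open>The sum consists of h (j - 3), h (j - 1), h j and hb (j + 1). The other terms of the
  Hamiltonian commute with \<open>Y\<close>, so this is all of [H, Y].\<close>

lemma commutator_Y:
  "(d + f + e + p * a * d * e) * Y - Y * (d + f + e + p * a * d * e) = 2 * W"
  unfolding Y_def W_def mult_2 by (simp only: normalize) simp

text \<open>The transfer matrix will be split into four summands according to which of
  \<open>a\<close>, \<open>d\<close>, \<open>e\<close>, \<open>f\<close> anticommute with the remote
  factor \<open>x\<close>. Here \<open>x\<close> is t (j - 6), which commutes with all of
  them.\<close>

lemma intertwine_commuting:
  assumes x: "a * x = x * a" "d * x = x * d" "e * x = x * e" "f * x = x * f" "n * x = x * n"
  defines "T \<equiv> x * (1 - u*d - u*a - u*f - u*e + u*u*e*d - u*p*a*d*e + u*u*p*a*d*e*a)"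
  shows "T * (Y + u * W) = (Y - u * W) * T"
  unfolding Y_def W_def T_def
  by (simp only: normalize scalar_swap[of x] x x[THEN lift]) simp

text \<open>The case of \<open>x\<close> = t (j - 4) - t (j - 5).\<close>

lemma intertwine_anti_ad:
  assumes x: "e * x = x * e" "f * x = x * f" "n * x = x * n" "a * x = - (x * a)" "d * x = - (x * d)"
  defines "T \<equiv> x - u*f*x - u*e*x - u*p*a*d*e*x"
  shows "T * (Y + u * W) = (Y - u * W) * T"
  unfolding Y_def W_def T_def
  by (simp only: normalize scalar_swap[of x] x x(1-3)[THEN lift] x(4-)[THEN lift_minus]) simp

text \<open>The case of the terms containing hb (j - 1) but not h (j - 4).\<close>

lemma intertwine_anti_adef:
  assumes x: "n * x = x * n" "a * x = - (x * a)" "d * x = - (x * d)" "e * x = - (x * e)"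
    "f * x = - (x * f)"
  shows "(u * x) * (Y + u * W) = (Y - u * W) * (u * x)"
  unfolding Y_def W_def
  by (simp only: normalize scalar_swap[of x] x x(1)[THEN lift] x(2-)[THEN lift_minus]) simp

text \<open>The hypothesis rec is the recursion for the couplings; the other three cases hold for arbitrary
  couplings.\<close>
lemma intertwine_anti_d:
  assumes x: "a * x = x * a" "e * x = x * e" "f * x = x * f" "n * x = x * n" "d * x = - (x * d)"
    and rec: "q * g * x = p * x + q * p * se * x"
  defines "T \<equiv> u*u*f*x + u*u*e*x - u*x + u*u*g*a*x"
  shows "T * (Y + u * W) = (Y - u * W) * T"
proof -
  \<comment> \<open>The hypothesis \<open>rec\<close> times u^3, with scalars in the order produced
    by \<open>normalize\<close>, so that it can be used as a rewrite rule.\<close>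
  have rec': "g * (q * (u * (u * (u * (x * w))))) =
      p * (u * (u * (u * (x * w)))) + se * (q * (p * (u * (u * (u * (x * w))))))" for w
  proof -
    have "g * (q * (u * (u * (u * (x * w))))) = u * (u * (u * ((q * g * x) * w)))"
      by (simp only: mult.assoc scalar_swaps)
    then show ?thesis
      unfolding rec by (simp only: mult.assoc scalar_swaps distrib_left distrib_right)
  qed
  show ?thesis
    unfolding Y_def W_def T_def
    by (simp only: normalize scalar_swap[of x] x x(1-4)[THEN lift] x(5)[THEN lift_minus])
      (simp add: rec')
qed

end


section \<open>The algebra of the chain\<close>

text \<open>Integer indices with zero extension make the recursions uniform near the left end.
  \<open>\<beta>\<close> is indexed by the odd subscript, and \<open>\<beta>_rec\<close> is the
  coupling recursion with the denominator cleared, restricted to those \<open>n\<close> for which h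
  (n + 2) is present.\<close>

locale claw_chain = central_scalars c
  for c :: "complex \<Rightarrow> 'a::ring_1" +
  fixes h :: "int \<Rightarrow> 'a" and b \<beta> :: "int \<Rightarrow> complex"
  assumes h_sq: "h i * h i = c ((b i)\<^sup>2)"
    and h_anticomm: "\<bar>i - l\<bar> \<in> {1, 2} \<Longrightarrow> h i * h l = - (h l * h i)"
    and h_comm: "\<bar>i - l\<bar> > 2 \<Longrightarrow> h i * h l = h l * h i"
    and h_nonpos: "i \<le> 0 \<Longrightarrow> h i = 0"
    and \<beta>_rec: "even n \<Longrightarrow> 6 \<le> n \<Longrightarrow> h (n + 2) \<noteq> 0 \<Longrightarrow>
      \<beta> (n + 1) * (1 + (b (n - 4))\<^sup>2 * \<beta> (n - 3)) = \<beta> (n - 1) * (1 + (b n)\<^sup>2 * \<beta> (n + 1))"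
begin

definition hb :: "int \<Rightarrow> 'a" where
  "hb p = c (\<beta> (p - 2)) * h (p - 3) * h (p - 4) * h (p - 1)"

fun val :: "int \<times> bool \<Rightarrow> 'a" where
  "val (l, False) = h l"
| "val (p, True) = hb p"

definition sg :: "int \<Rightarrow> int \<Rightarrow> complex" where
  "sg i l = (if \<bar>i - l\<bar> \<in> {1, 2} then -1 else 1)"

lemma h_swap: "h i * h l = c (sg i l) * (h l * h i)"
proof (cases "\<bar>i - l\<bar> \<in> {1, 2}")
  case True
  then show ?thesis
    using h_anticomm[OF True] by (simp add: sg_def c_minus del: insert_iff)
next
  case False
  then have "h i * h l = h l * h i"
    using h_comm[of i l] by (cases "i = l") auto
  with False show ?thesis
    by (simp add: sg_def del: insert_iff)
qed

lemma swap_mult: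
  assumes "x * y = c r * (y * x)" "x * z = c s * (z * x)"
  shows "x * (y * z) = c (r * s) * ((y * z) * x)"
proof -
  have "x * (y * z) = c r * (y * (x * z))"
    by (metis assms(1) mult.assoc)
  also have "\<dots> = c (r * s) * ((y * z) * x)"
    unfolding assms(2) by (simp add: c_mult c_left_comm[of y] mult.assoc)
  finally show ?thesis .
qed

lemma swap_sym:
  assumes "x * y = c r * (y * x)" "r * r = 1"
  shows "y * x = c r * (x * y)"
  using assms by (simp add: mult.assoc[symmetric] c_mult[symmetric])

lemma swap_hb:
  assumes "x * h (p - 3) = c r * (h (p - 3) * x)" "x * h (p - 4) = c s * (h (p - 4) * x)"
    "x * h (p - 1) = c s' * (h (p - 1) * x)"
  shows "x * hb p = c (r * s * s') * (hb p * x)"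
proof -
  have "x * c (\<beta> (p - 2)) = c 1 * (c (\<beta> (p - 2)) * x)"
    by (simp add: c_comm[of _ x])
  from swap_mult[OF swap_mult[OF swap_mult[OF this assms(1)] assms(2)] assms(3)]
  show ?thesis
    by (simp add: hb_def)
qed

definition sgb :: "int \<Rightarrow> int \<Rightarrow> complex" where
  "sgb l p = (if l \<in> {p - 6, p - 4, p - 2, p, p - 1, p + 1} then -1 else 1)"

text \<open>\<open>hb p\<close> is a product of three generators, and h l anticommutes with it
  exactly if it anticommutes with an odd number of them. The neighbour list of the frustration graph
  is this parity count.\<close>

lemma hb_neighbour_parity:
  fixes l p :: int
  shows "l \<in> {p - 6, p - 4, p - 2, p, p - 1, p + 1} \<longleftrightarrow>
      ((\<bar>l - (p - 3)\<bar> \<in> {1, 2}) \<noteq> ((\<bar>l - (p - 4)\<bar> \<in> {1, 2}) \<noteq> (\<bar>l - (p - 1)\<bar> \<in> {1, 2})))"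
proof (cases "l \<in> {p - 6..p + 1}")
  case True
  then have "l - p \<in> {-6..1}" by auto
  also have "{-6..1::int} = {-6, -5, -4, -3, -2, -1, 0, 1}" by auto
  finally obtain k where "l = p + k" "k \<in> {-6, -5, -4, -3, -2, -1, 0, 1}" 
    by (metis add.commute diff_add_cancel)
  then show ?thesis by auto
next
  case False
  then have "l < p - 6 \<or> p + 1 < l" by auto
  then have "2 < \<bar>l - (p - 3)\<bar>" "2 < \<bar>l - (p - 4)\<bar>" "2 < \<bar>l - (p - 1)\<bar>" "l \<notin> {p - 6, p - 4, p - 2, p, p - 1, p + 1}"
    by auto
  then show ?thesis by (simp del: insert_iff) simp
qed

lemma h_hb_swap: "h l * hb p = c (sgb l p) * (hb p * h l)"
proof -
  have "sgb l p = sg l (p - 3) * sg l (p - 4) * sg l (p - 1)"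
    unfolding sgb_def sg_def hb_neighbour_parity by (simp del: insert_iff)
  then show ?thesis
    using swap_hb[of "h l" p, OF h_swap h_swap h_swap] by simp
qed

lemma hb_h_swap: "hb p * h l = c (sgb l p) * (h l * hb p)"
  by (rule swap_sym[OF h_hb_swap]) (simp add: sgb_def)

text \<open>The same parity count, now over the three factors of \<open>hb q\<close> moved past
  \<open>hb p\<close>.\<close>

lemma hb_hb_swap:
  assumes "odd p" "odd q"
  shows "hb p * hb q = c (if \<bar>p - q\<bar> = 2 then -1 else 1) * (hb q * hb p)"
proof -
  have "\<bar>p - q\<bar> = 2 \<longleftrightarrow>
      ((q - 3 \<in> {p - 6, p - 4, p - 2, p, p - 1, p + 1}) \<noteq>
      ((q - 4 \<in> {p - 6, p - 4, p - 2, p, p - 1, p + 1}) \<noteq>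
        (q - 1 \<in> {p - 6, p - 4, p - 2, p, p - 1, p + 1})))"
    using assms by simp presburger
  then have "sgb (q - 3) p * sgb (q - 4) p * sgb (q - 1) p = (if \<bar>p - q\<bar> = 2 then -1 else 1)"
    unfolding sgb_def by (simp del: insert_iff)
  then show ?thesis
    using swap_hb[of "hb p" q, OF hb_h_swap hb_h_swap hb_h_swap] by simp
qed

text \<open>Only for odd labels of the \<open>hb\<close> vertices does \<open>adj\<close> describe
  which values anticommute.\<close>

definition vertices :: "(int \<times> bool) set" where
  "vertices = {(l, x). x \<longrightarrow> odd l}"

lemma val_swap:
  assumes "v \<in> vertices" "w \<in> vertices"
  shows "val v * val w = c (if adj v w then -1 else 1) * (val w * val v)"
proof -
  obtain l x m y where v: "v = (l, x)" "w = (m, y)"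
    by (metis surj_pair)
  show ?thesis
  proof (cases x; cases y)
    assume "x" "y"
    with v assms hb_hb_swap[of l m] show ?thesis by (simp add: vertices_def)
  next
    assume "x" "\<not> y"
    with v hb_h_swap[of l m] show ?thesis by (simp add: sgb_def)
  next
    assume "\<not> x" "y"
    with v h_hb_swap[of l m] show ?thesis by (simp add: sgb_def)
  next
    assume "\<not> x" "\<not> y"
    with v h_swap[of l m] show ?thesis by (simp add: sg_def)
  qed
qed

lemma val_comm:
  assumes "v \<in> vertices" "w \<in> vertices" "\<not> adj v w"
  shows "val v * val w = val w * val v"
  using val_swap[OF assms(1,2)] assms(3) by simp

lemma adj_sym: "adj v w \<longleftrightarrow> adj w v"
  by (cases v; cases w; cases "snd v"; cases "snd w") auto

lemma adj_irrefl: "\<not> adj v v"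
  by (cases v; cases "snd v") auto


section \<open>Independence polynomials\<close>

text \<open>The independence polynomial of an induced subgraph with operator weights, evaluated at
  -u. On the full vertex set it is the transfer matrix.\<close>

definition ipoly :: "complex \<Rightarrow> (int \<times> bool) set \<Rightarrow> 'a" where
  "ipoly u V = (\<Sum>S\<in>{S. S \<subseteq> V \<and> indep S}. c ((- u) ^ card S) * oprod val S)"

text \<open>The new factor may land anywhere in the sorted list; since it commutes with the others
  it can be pulled to the front.\<close>

lemma oprod_insert:
  fixes g :: "int \<times> bool \<Rightarrow> 'a"
  assumes "finite S" "v \<notin> S" "\<And>w. w \<in> S \<Longrightarrow> g v * g w = g w * g v"
  shows "oprod g (insert v S) = g v * oprod g S"
proof -
  have "prod_list (map g (insort v xs)) = g v * prod_list (map g xs)"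
    if "\<And>w. w \<in> set xs \<Longrightarrow> g v * g w = g w * g v" for xs
    using that
  proof (induction xs)
    case (Cons x xs)
    then have "g x * (g v * r) = g v * (g x * r)" for r
      by (metis list.set_intros(1) mult.assoc)
    with Cons show ?case
      by (auto simp: mult.assoc)
  qed auto
  from this[of "sorted_list_of_set S"] show ?thesis
    using assms by (simp add: oprod_def)
qed

lemma indep_insert:
  "indep (insert v S) \<longleftrightarrow> indep S \<and> (\<forall>w\<in>S. \<not> adj v w)"
  using adj_sym adj_irrefl by (auto simp: indep_def)

text \<open>Vertex deletion: independent sets are split by whether they contain \<open>v\<close>,
  and those that do avoid its neighbours. The alternative \<open>val v = 0\<close> covers vertices
  beyond the left end.\<close>

lemma ipoly_delete:
  assumes "finite V" "V \<subseteq> vertices" "v \<in> vertices" "v \<in> V \<or> val v = 0"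
  shows "ipoly u V = ipoly u (V - {v}) - c u * (val v * ipoly u {w \<in> V - {v}. \<not> adj v w})"
proof (cases "v \<in> V")
  case False
  with assms show ?thesis by simp
next
  case True
  let ?A = "{S. S \<subseteq> V - {v} \<and> indep S}"
  let ?B = "{S. S \<subseteq> {w \<in> V - {v}. \<not> adj v w} \<and> indep S}"
  have fin: "finite ?A" "finite ?B"
    using assms(1) by auto
  have finS: "finite S" if "S \<subseteq> {w \<in> V - {v}. \<not> adj v w}" for S
    using that assms(1) by (auto intro: finite_subset[of S V])
  have eq: "{S. S \<subseteq> V \<and> indep S} = ?A \<union> insert v ` ?B"
  proof (intro equalityI subsetI)
    fix S assume S: "S \<in> {S. S \<subseteq> V \<and> indep S}"
    show "S \<in> ?A \<union> insert v ` ?B"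
    proof (cases "v \<in> S")
      case True
      then have "S = insert v (S - {v})" by auto
      moreover from this S have "S - {v} \<in> ?B"
        using indep_insert[of v "S - {v}"] by auto
      ultimately show ?thesis by blast
    qed (use S in auto)
  next
    fix S assume "S \<in> ?A \<union> insert v ` ?B"
    then show "S \<in> {S. S \<subseteq> V \<and> indep S}"
      using True by (auto simp: indep_insert)
  qed
  have "ipoly u V = ipoly u (V - {v}) +
      (\<Sum>S\<in>insert v ` ?B. c ((- u) ^ card S) * oprod val S)"
    unfolding ipoly_def eq using fin by (subst sum.union_disjoint) auto
  also have "(\<Sum>S\<in>insert v ` ?B. c ((- u) ^ card S) * oprod val S)
      = (\<Sum>S\<in>?B. c ((- u) ^ card (insert v S)) * oprod val (insert v S))"
    by (subst sum.reindex) (auto simp: inj_on_def)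
  also have "\<dots> = (\<Sum>S\<in>?B. - (c u * (val v * (c ((- u) ^ card S) * oprod val S))))"
  proof (rule sum.cong)
    fix S assume S: "S \<in> ?B"
    then have "oprod val (insert v S) = val v * oprod val S"
      using assms finS by (intro oprod_insert) (auto intro!: val_comm)
    moreover have "card (insert v S) = Suc (card S)"
      using S finS by (subst card_insert_disjoint) auto
    ultimately show "c ((- u) ^ card (insert v S)) * oprod val (insert v S)
        = - (c u * (val v * (c ((- u) ^ card S) * oprod val S)))"
      by (simp add: c_mult c_minus mult.assoc c_left_comm[of "val v"])
  qed auto
  also have "\<dots> = - (c u * (val v * ipoly u {w \<in> V - {v}. \<not> adj v w}))"
    by (simp add: ipoly_def sum_distrib_left sum_negf)
  finally show ?thesis by simp
qed

lemma ipoly_empty: "ipoly u {} = 1"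
proof -
  have "{S. S \<subseteq> {} \<and> indep S} = {{} :: (int \<times> bool) set}"
    by (auto simp: indep_def)
  then show ?thesis
    by (simp add: ipoly_def oprod_def)
qed

lemma ipoly_comm:
  assumes "finite V" "\<And>v. v \<in> V \<Longrightarrow> x * val v = val v * x"
  shows "x * ipoly u V = ipoly u V * x"
proof -
  have "x * oprod val S = oprod val S * x" if "S \<subseteq> V" for S
  proof -
    have "x * prod_list (map val xs) = prod_list (map val xs) * x" if "set xs \<subseteq> V" for xs
      using that
    proof (induction xs)
      case (Cons v xs)
      have "x * (val v * prod_list (map val xs)) = val v * (x * prod_list (map val xs))"
        using Cons.prems assms(2)[of v] by (metis list.set_intros(1) mult.assoc subsetD)
      with Cons show ?case by (simp add: mult.assoc)
    qed auto
    moreover have "set (sorted_list_of_set S) \<subseteq> V"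
      using that finite_subset[OF that assms(1)] by simp
    ultimately show ?thesis
      by (simp add: oprod_def)
  qed
  then show ?thesis
    unfolding ipoly_def sum_distrib_left sum_distrib_right
    by (intro sum.cong) (auto simp: c_left_comm[of x] mult.assoc)
qed

section \<open>Vertex sets of the chain and recursions for the transfer matrices\<close>

text \<open>The integer version of \<open>Vset\<close>. For p = 2m + 1 the condition 2 \<le> m \<le>
  j div 2 becomes p odd with 5 \<le> p \<le> j + 1.\<close>

definition V :: "int \<Rightarrow> (int \<times> bool) set" where
  "V j = {(l, x). if x then odd l \<and> 5 \<le> l \<and> l \<le> j + 1 else 1 \<le> l \<and> l \<le> j}"

abbreviation t :: "complex \<Rightarrow> int \<Rightarrow> 'a" where
  "t u j \<equiv> ipoly u (V j)"

lemma V_iff [simp]: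
  "(l, False) \<in> V j \<longleftrightarrow> 1 \<le> l \<and> l \<le> j"
  "(l, True) \<in> V j \<longleftrightarrow> odd l \<and> 5 \<le> l \<and> l \<le> j + 1"
  by (auto simp: V_def)

lemma vertex_set_eqI:
  assumes "\<And>l. (l, False) \<in> A \<longleftrightarrow> (l, False) \<in> B" "\<And>l. (l, True) \<in> A \<longleftrightarrow> (l, True) \<in> B"
  shows "A = (B :: (int \<times> bool) set)"
  by (smt (verit, best) assms subsetI subset_antisym surj_pair)

lemma finite_V: "finite (V j)"
proof (rule finite_subset)
  show "V j \<subseteq> {0..j + 1} \<times> UNIV"
    by (auto simp: V_def split: if_splits)
qed auto

lemma V_vertices: "V j \<subseteq> vertices"
  by (auto simp: V_def vertices_def split: if_splits)

lemma t_nonpos: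
  assumes "j \<le> 0"
  shows "t u j = 1"
proof -
  have "V j = {}"
    using assms by (auto simp: V_def split: if_splits)
  then show ?thesis
    by (simp add: ipoly_empty)
qed

lemma t_comm:
  assumes "\<And>i. i \<le> j \<Longrightarrow> x * h i = h i * x"
  shows "x * t u j = t u j * x"
proof (rule ipoly_comm[OF finite_V])
  fix v assume v: "v \<in> V j"
  show "x * val v = val v * x"
  proof (cases v)
    case (Pair p y)
    show ?thesis
    proof (cases y)
      case True
      with v Pair have "p \<le> j + 1" by (auto simp: V_def)
      then have "x * hb p = c (1 * 1 * 1) * (hb p * x)"
        by (intro swap_hb) (auto intro: assms)
      with True Pair show ?thesis by simp
    qed (use v Pair in \<open>auto simp: V_def intro: assms\<close>)
  qed
qed

lemma h_pos_or_0: "1 \<le> j \<or> h j = 0"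
  using h_nonpos[of j] by linarith

text \<open>Deletion of h j. Its neighbours in \<open>V j\<close> are h (j - 1), h (j - 2) and hb j
  as far as these exist, which leaves \<open>V (j - 3)\<close>.\<close>

lemma t_odd:
  assumes "odd j"
  shows "t u j = t u (j - 1) - c u * (h j * t u (j - 3))"
proof -
  have 1: "V j - {(j, False)} = V (j - 1)"
    by (rule vertex_set_eqI; use assms in simp; presburger?)
  have 2: "{w \<in> V (j - 1). \<not> adj (j, False) w} = V (j - 3)"
    by (rule vertex_set_eqI; use assms in simp; presburger?)
  show ?thesis
    using ipoly_delete[OF finite_V V_vertices, of "(j, False)" j u] h_pos_or_0[of j]
    unfolding 1 2 by (simp add: vertices_def)
qed

text \<open>What remains of \<open>V j\<close> once hb (j + 3) has been chosen. For even
  \<open>j\<close> this removes h (j - 3), h (j - 1) and hb (j + 1).\<close>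

definition sv :: "int \<Rightarrow> (int \<times> bool) set" where
  "sv j = {v \<in> V j. \<not> adj (j + 3, True) v}"

text \<open>The value of \<open>ipoly u (sv j)\<close> found in \<open>s_eq\<close>: starting from
  \<open>V (j - 2)\<close>, the term with the plus sign takes h (j - 3) out and the term with the
  minus sign puts h j in.\<close>

definition s :: "complex \<Rightarrow> int \<Rightarrow> 'a" where
  "s u j = t u (j - 2) + c u * (h (j - 3) * t u (j - 6)) - c u * (h j * t u (j - 4))"

lemma hb_small: "p < 5 \<Longrightarrow> hb p = 0"
  by (simp add: hb_def h_nonpos)

lemma s_eq:
  assumes "even j" "2 \<le> j"
  shows "ipoly u (sv j) = s u j"
proof -
  have sub: "sv j \<subseteq> V j"
    by (auto simp: sv_def)
  have 1: "{w \<in> sv j - {(j, False)}. \<not> adj (j, False) w} = V (j - 4)"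
    by (rule vertex_set_eqI; use assms in \<open>simp add: sv_def\<close>; presburger?)
  have 2: "V (j - 2) - {(j - 3, False)} = sv j - {(j, False)}"
    by (rule vertex_set_eqI; use assms in \<open>simp add: sv_def\<close>; presburger?)
  have 3: "{w \<in> sv j - {(j, False)}. \<not> adj (j - 3, False) w} = V (j - 6)"
    by (rule vertex_set_eqI; use assms in \<open>simp add: sv_def\<close>; presburger?)
  have "ipoly u (sv j) = ipoly u (sv j - {(j, False)}) - c u * (h j * t u (j - 4))"
    using ipoly_delete[of "sv j" "(j, False)" u] finite_subset[OF sub finite_V] sub V_vertices assms
    unfolding 1 by (auto simp: vertices_def sv_def)
  moreover have "t u (j - 2) = ipoly u (sv j - {(j, False)}) - c u * (h (j - 3) * t u (j - 6))"
    using ipoly_delete[OF finite_V V_vertices, of "(j - 3, False)" "j - 2" u] h_pos_or_0[of "j - 3"]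
    unfolding 2 3 by (simp add: vertices_def)
  ultimately show ?thesis
    by (simp add: s_def)
qed

text \<open>Deletion of hb (j + 1), which leaves \<open>sv (j - 2)\<close> as its non-neighbours,
  followed by deletion of h j. For j below 4 there is no such \<open>hb\<close> vertex and its value
  is zero.\<close>

lemma t_even:
  assumes "even j"
  shows "t u j = t u (j - 1) - c u * (h j * t u (j - 3)) - c u * (hb (j + 1) * s u (j - 2))"
proof (cases "4 \<le> j")
  case False
  then show ?thesis
  proof (cases "j = 2")
    case True
    have 1: "V 2 - {(2, False)} = V 1" "{w \<in> V 1. \<not> adj (2, False) w} = V (-1)"
      by (rule vertex_set_eqI; simp; presburger?)+
    show ?thesis
      using ipoly_delete[OF finite_V V_vertices, of "(2, False)" 2 u] True
      unfolding 1 by (simp add: vertices_def hb_small)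
  next
    case False
    with \<open>\<not> 4 \<le> j\<close> assms have "j \<le> 0" by presburger
    then show ?thesis
      by (simp add: t_nonpos h_nonpos hb_small)
  qed
next
  case True
  let ?U = "V j - {(j + 1, True)}"
  have 1: "{w \<in> V j - {(j + 1, True)}. \<not> adj (j + 1, True) w} = sv (j - 2)"
    by (rule vertex_set_eqI; use assms in \<open>simp add: sv_def\<close>; presburger?)
  have 2: "?U - {(j, False)} = V (j - 1)"
    by (rule vertex_set_eqI; use assms in simp; presburger?)
  have 3: "{w \<in> V (j - 1). \<not> adj (j, False) w} = V (j - 3)"
    by (rule vertex_set_eqI; use assms in simp; presburger?)
  have "t u j = ipoly u ?U - c u * (hb (j + 1) * ipoly u (sv (j - 2)))"
    using ipoly_delete[OF finite_V V_vertices, of "(j + 1, True)" j u] True assms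
    unfolding 1 by (auto simp: vertices_def)
  moreover have "ipoly u ?U = t u (j - 1) - c u * (h j * t u (j - 3))"
    using ipoly_delete[of ?U "(j, False)" u] V_vertices[of j] True finite_V[of j]
    unfolding 2 3 by (auto simp: vertices_def)
  moreover have "ipoly u (sv (j - 2)) = s u (j - 2)"
    using True assms by (intro s_eq) auto
  ultimately show ?thesis by simp
qed

text \<open>Grouping by cardinality recovers the expansion of the transfer matrix in the
  charges.\<close>

lemma ipoly_by_card:
  assumes "finite U"
  shows "ipoly u U = (\<Sum>k\<le>card U. c ((- u) ^ k) *
    (\<Sum>S\<in>{S. S \<subseteq> U \<and> indep S \<and> card S = k}. oprod val S))"
proof -
  let ?A = "{S. S \<subseteq> U \<and> indep S}"
  have "ipoly u U = (\<Sum>k\<le>card U. \<Sum>S\<in>{S \<in> ?A. card S = k}. c ((- u) ^ card S) * oprod val S)"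
    unfolding ipoly_def using assms by (intro sum.group[symmetric]) (auto intro: card_mono)
  also have "\<dots> = (\<Sum>k\<le>card U. c ((- u) ^ k) *
      (\<Sum>S\<in>{S. S \<subseteq> U \<and> indep S \<and> card S = k}. oprod val S))"
    by (auto simp: sum_distrib_left conj_assoc intro!: sum.cong)
  finally show ?thesis .
qed

lemma anticommutator_scale:
  "c a * x * (c a' * y) + c a' * y * (c a * x) = c (a * a') * (x * y + y * x)"
  by (simp add: c_mult distrib_left mult.assoc c_left_comm[of x] c_left_comm[of y]
    c_left_comm[of "c a'"])


section \<open>Intertwined elements\<close>

definition com :: "'a \<Rightarrow> 'a \<Rightarrow> bool" where
  "com x y \<longleftrightarrow> x * y = y * x"

definition ant :: "'a \<Rightarrow> 'a \<Rightarrow> bool" where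
  "ant x y \<longleftrightarrow> x * y = - (y * x)"

lemma com_rules:
  "com x (c r)" "com x 1" "com x y \<Longrightarrow> com x (- y)"
  "com x y \<Longrightarrow> com x z \<Longrightarrow> com x (y + z)" "com x y \<Longrightarrow> com x z \<Longrightarrow> com x (y - z)"
  by (auto simp: com_def distrib_left distrib_right left_diff_distrib right_diff_distrib
      c_comm[of r x])

lemma com_mult: "com x y \<Longrightarrow> com x z \<Longrightarrow> com x (y * z)"
  unfolding com_def by (metis mult.assoc)

lemma com_mult_ant: "ant x y \<Longrightarrow> ant x z \<Longrightarrow> com x (y * z)"
  unfolding com_def ant_def by (metis mult.assoc mult_minus_left mult_minus_right minus_minus)

lemma ant_rules:
  "ant x y \<Longrightarrow> ant x (- y)"
  "ant x y \<Longrightarrow> ant x z \<Longrightarrow> ant x (y + z)" "ant x y \<Longrightarrow> ant x z \<Longrightarrow> ant x (y - z)"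
  by (auto simp: ant_def distrib_left distrib_right left_diff_distrib right_diff_distrib)

lemma ant_mult_left: "ant x y \<Longrightarrow> com x z \<Longrightarrow> ant x (y * z)"
  unfolding com_def ant_def by (metis mult.assoc mult_minus_left)

lemma ant_mult_right: "com x y \<Longrightarrow> ant x z \<Longrightarrow> ant x (y * z)"
  unfolding com_def ant_def by (metis mult.assoc mult_minus_right)

lemmas ant_scale = ant_mult_right[OF com_rules(1)]
lemmas com_scale = com_mult[OF com_rules(1)]

lemma com_sym: "com x y \<Longrightarrow> com y x"
  by (simp add: com_def)

lemma ant_sym: "ant x y \<Longrightarrow> ant y x"
  by (simp add: ant_def)

lemma com_h: "\<bar>i - l\<bar> \<notin> {1, 2} \<Longrightarrow> com (h i) (h l)"
  using h_swap[of i l] by (simp add: com_def sg_def)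

lemma ant_h: "\<bar>i - l\<bar> \<in> {1, 2} \<Longrightarrow> ant (h i) (h l)"
  using h_anticomm[of i l] by (simp add: ant_def)

lemma com_h_hb:
  assumes "l \<notin> {p - 6, p - 4, p - 2, p, p - 1, p + 1}"
  shows "com (h l) (hb p)" "com (hb p) (h l)"
  using assms h_hb_swap[of l p] by (auto simp: com_def sgb_def)

lemma ant_h_hb:
  assumes "l \<in> {p - 6, p - 4, p - 2, p, p - 1, p + 1}"
  shows "ant (h l) (hb p)" "ant (hb p) (h l)"
proof -
  show "ant (h l) (hb p)"
    using assms h_hb_swap[of l p] unfolding ant_def sgb_def by (simp add: c_minus del: insert_iff)
  then show "ant (hb p) (h l)"
    by (rule ant_sym)
qed

lemma ant_hb: "odd p \<Longrightarrow> ant (hb p) (hb (p - 2))"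
  using hb_hb_swap[of p "p - 2"] by (simp add: ant_def c_minus)

lemma com_hb: "com x (h (p - 3)) \<Longrightarrow> com x (h (p - 4)) \<Longrightarrow> com x (h (p - 1)) \<Longrightarrow> com x (hb p)"
  unfolding hb_def by (intro com_mult com_rules)

lemma com_t: "(\<And>i. i \<le> j \<Longrightarrow> com x (h i)) \<Longrightarrow> com x (t u j)"
  unfolding com_def by (rule t_comm)

lemma com_s: "(\<And>i. i \<le> j \<Longrightarrow> com x (h i)) \<Longrightarrow> com x (s u j)"
  unfolding s_def by (intro com_mult com_rules com_t) auto

section \<open>The Hamiltonian and its recursion\<close>

definition ham :: "int \<Rightarrow> 'a" where
  "ham j = (\<Sum>v\<in>V j. val v)"

lemma ham_nonpos: "j \<le> 0 \<Longrightarrow> ham j = 0"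
proof -
  assume "j \<le> 0"
  then have "V j = {}"
    by (auto simp: V_def split: if_splits)
  then show ?thesis
    by (simp add: ham_def)
qed

lemma ham_odd:
  assumes "odd j"
  shows "ham j = ham (j - 1) + h j"
proof (cases "1 \<le> j")
  case True
  have "V j = insert (j, False) (V (j - 1))"
    by (rule vertex_set_eqI; use assms True in simp; presburger)
  then show ?thesis
    by (simp add: ham_def finite_V add.commute)
qed (simp add: ham_nonpos h_nonpos)

lemma ham_even:
  assumes "even j"
  shows "ham j = ham (j - 1) + h j + hb (j + 1)"
proof (cases "1 \<le> j")
  case True
  have "V j - {(j + 1, True)} = insert (j, False) (V (j - 1))"
    by (rule vertex_set_eqI; use assms True in simp; presburger)
  then have "(\<Sum>v\<in>V j - {(j + 1, True)}. val v) = ham (j - 1) + h j"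
    by (simp add: ham_def finite_V add.commute)
  moreover have "ham j = (\<Sum>v\<in>V j - {(j + 1, True)}. val v) + hb (j + 1)"
  proof (cases "4 \<le> j")
    case True
    then show ?thesis
      unfolding ham_def using assms finite_V[of j]
      by (subst sum.remove[of _ "(j + 1, True)"]) (auto simp: add.commute)
  next
    case False
    then show ?thesis
      by (simp add: ham_def hb_small)
  qed
  ultimately show ?thesis
    by simp
qed (simp add: ham_nonpos h_nonpos hb_small)

lemma com_ham: "(\<And>i. i \<le> j \<Longrightarrow> com x (h i)) \<Longrightarrow> com x (ham j)"
  unfolding ham_def com_def sum_distrib_left sum_distrib_right
proof (rule sum.cong)
  fix v assume x: "\<And>i. i \<le> j \<Longrightarrow> x * h i = h i * x" and v: "v \<in> V j"
  show "x * val v = val v * x"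
  proof (cases "snd v")
    case True
    then obtain p where p: "v = (p, True)" by (metis prod.collapse)
    with v have "com x (hb p)"
      by (intro com_hb) (auto simp: com_def intro: x)
    with p show ?thesis by (simp add: com_def)
  next
    case False
    then obtain p where "v = (p, False)" by (metis prod.collapse)
    with v x show ?thesis by simp
  qed
qed auto

section \<open>The intertwining relation and the clique of even size\<close>

text \<open>Twice the relation T (x + u/2 [H, x]) = (x - u/2 [H, x]) T.\<close>
definition mode :: "complex \<Rightarrow> int \<Rightarrow> 'a \<Rightarrow> bool" where
  "mode u j x \<longleftrightarrow> 2 * (t u j * x - x * t u j) =
    - (c u * (t u j * (ham j * x - x * ham j) + (ham j * x - x * ham j) * t u j))"

lemma mode_0: "mode u j 0"
  by (simp add: mode_def)

lemma mode_add:
  assumes "mode u j x" "mode u j y"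
  shows "mode u j (x + y)"
proof -
  let ?L = "\<lambda>x. 2 * (t u j * x - x * t u j)"
  let ?R = "\<lambda>x. - (c u * (t u j * (ham j * x - x * ham j) + (ham j * x - x * ham j) * t u j))"
  have "?L (x + y) = ?L x + ?L y" "?R (x + y) = ?R x + ?R y"
    by (simp_all add: algebra_simps)
  with assms show ?thesis
    unfolding mode_def by simp
qed

text \<open>The recursions are unfolded until \<open>a\<close>, \<open>d\<close>, \<open>e\<close>,
  \<open>f\<close> are explicit and the remaining factors \<open>t u (j - 6)\<close>,
  \<open>X\<close>, \<open>X'\<close>, \<open>L\<close> each commute or anticommute with every one
  of them. The four resulting summands are then intertwined separately.\<close>

lemma mode_clique:
  assumes "even j"
  shows "mode u j (h (j + 2) + hb (j + 3))"
proof (cases "h (j + 2) = 0")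
  case True
  \<comment> \<open>hb (j + 3) contains the factor h (j + 2). In the other case h (j + 2) is
    nonzero, which makes \<open>\<beta>_rec\<close> available.\<close>
  then have "hb (j + 3) = 0" by (simp add: hb_def add.commute[of 2 j])
  with True show ?thesis by (simp add: mode_0)
next
  case False
  define a d e f n where "a = h (j - 2)" "d = h (j - 3)" "e = h j" "f = h (j - 1)" "n = h (j + 2)"
  define p q where "p = c (\<beta> (j - 1))" "q = c (\<beta> (j + 1))"
  \<comment> \<open>The coefficient of u^2 \<open>a * L\<close>: the 1 comes from
    \<open>t u (j - 5)\<close>, the rest from hb (j - 1) meeting h (j - 4) in
    \<open>s u (j - 4)\<close>.\<close>
  define g where "g = c (1 + (b (j - 4))\<^sup>2 * \<beta> (j - 3))"
  define L where "L = h (j - 5) * t u (j - 8)"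
  define X where "X = t u (j - 4) - t u (j - 5)"
  define X' where "X' = hb (j - 1) * (t u (j - 6) + c u * (h (j - 7) * t u (j - 10)))"
  interpret cluster "c u" p q g "c ((b (j - 2))\<^sup>2)" "c ((b (j - 3))\<^sup>2)" "c ((b j)\<^sup>2)" "c ((b (j - 1))\<^sup>2)"
    a d e f n
  proof
    show "n * a = a * n" "e * d = d * e" "n * d = d * n" "n * f = f * n"
      unfolding a_d_e_f_n_def by (auto intro: h_comm)
    show "d * a = - (a * d)" "e * a = - (a * e)" "f * a = - (a * f)" "f * d = - (d * f)"
      "f * e = - (e * f)" "n * e = - (e * n)"
      unfolding a_d_e_f_n_def by (auto intro: h_anticomm)
  qed (auto simp: a_d_e_f_n_def p_q_def g_def h_sq intro: c_comm)
  have Y_eq: "Y = h (j + 2) + hb (j + 3)"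
    unfolding Y_def hb_def by (simp add: p_q_def a_d_e_f_n_def mult.assoc add.commute)
  have hb_eq: "hb (j + 1) = p * a * d * e"
    unfolding hb_def by (simp add: p_q_def a_d_e_f_n_def mult.assoc)
  have t0: "t u j = t u (j - 1) - c u * (e * t u (j - 3)) - c u * (p * a * d * e * s u (j - 2))"
    using t_even[OF assms, of u] by (simp add: hb_eq a_d_e_f_n_def)
  have t1: "t u (j - 1) = t u (j - 2) - c u * (f * t u (j - 4))"
    using t_odd[of "j - 1" u] assms by (simp add: a_d_e_f_n_def)
  have t2: "t u (j - 2) = t u (j - 3) - c u * (a * t u (j - 5)) - c u * (hb (j - 1) * s u (j - 4))"
    using t_even[of "j - 2" u] assms by (simp add: a_d_e_f_n_def)
  have t3: "t u (j - 3) = t u (j - 4) - c u * (d * t u (j - 6))"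
    using t_odd[of "j - 3" u] assms by (simp add: a_d_e_f_n_def)
  have t5: "t u (j - 5) = t u (j - 6) - c u * L"
    using t_odd[of "j - 5" u] assms by (simp add: L_def)
  have s2: "s u (j - 2) = t u (j - 4) + c u * L - c u * (a * t u (j - 6))"
    by (simp add: s_def L_def a_d_e_f_n_def)
  \<comment> \<open>h (j - 4) is already a factor of hb (j - 1). Moving it past two anticommuting
    factors gives no sign, and its square is a scalar.\<close>
  have "hb (j - 1) * (h (j - 4) * t u (j - 8)) = (g - 1) * (a * L)"
  proof -
    have "hb (j - 1) * (h (j - 4) * t u (j - 8)) =
        c (\<beta> (j - 3)) * (h (j - 4) * h (j - 4) * h (j - 2) * h (j - 5) * t u (j - 8))"
      using ant_h[of "j - 5" "j - 4"] ant_h[of "j - 2" "j - 4"] com_h[of "j - 5" "j - 2"]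
      unfolding hb_def ant_def com_def
      by (simp add: mult.assoc) (metis (no_types) mult.assoc mult_minus_left mult_minus_right minus_minus)
    then show ?thesis
      by (simp add: g_def c_add h_sq a_d_e_f_n_def L_def mult.assoc c_mult c_left_comm[of "c (\<beta> (j - 3))"])
  qed
  then have s4: "hb (j - 1) * s u (j - 4) = X' - c u * ((g - 1) * (a * L))"
    by (simp add: s_def X'_def distrib_left right_diff_distrib c_left_comm[of "hb (j - 1)"])
  define T0 where "T0 = t u (j - 6) * (1 - c u*d - c u*a - c u*f - c u*e + c u*c u*e*d - c u*p*a*d*e
      + c u*c u*p*a*d*e*a)"
  define T1 where "T1 = X - c u*f*X - c u*e*X - c u*p*a*d*e*X"
  define T2 where "T2 = c u*c u*f*L + c u*c u*e*L - c u*L + c u*c u*g*a*L"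
  have far: "com x (h i)" if "x \<in> {a, d, e, f, n}" "i \<le> j - 6" for x i
    using that unfolding a_d_e_f_n_def by (auto intro!: com_h)
  have far_t: "com x (t u i)" "com x (s u i)" if "x \<in> {a, d, e, f, n}" "i \<le> j - 6" for x i
    using that by (auto intro!: com_t com_s far)
  have t6: "t u (j - 6) * x = x * t u (j - 6)" if "x \<in> {a, d, e, f, n}" for x
    using far_t(1)[OF that, of "j - 6"] by (simp add: com_def)
  have comL: "com x L" if "x \<in> {a, e, f, n}" for x
    unfolding L_def using that by (intro com_mult far_t) (auto simp: a_d_e_f_n_def intro: com_h)
  have antL: "ant d L"
    unfolding L_def by (intro ant_mult_left far_t) (auto simp: a_d_e_f_n_def intro: ant_h)
  have X_eq: "X = - (c u * (h (j - 4) * t u (j - 7))) - c u * (hb (j - 3) * s u (j - 6))"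
    using t_even[of "j - 4" u] assms by (simp add: X_def)
  have comX: "com x X" if "x \<in> {e, f, n}" for x
    unfolding X_eq using that
    by (intro com_rules com_scale com_mult far_t)
      (auto simp: a_d_e_f_n_def intro: com_h com_h_hb)
  have antX: "ant x X" if "x \<in> {a, d}" for x
    unfolding X_eq using that
    by (intro ant_rules ant_scale ant_mult_left far_t)
      (auto simp: a_d_e_f_n_def intro: ant_h ant_h_hb)
  have antX': "ant x X'" if "x \<in> {a, d, e, f}" for x
    unfolding X'_def using that
    by (intro ant_mult_left com_rules com_scale com_mult far_t far)
      (auto simp: a_d_e_f_n_def intro: ant_h_hb)
  have comX': "com n X'"
    unfolding X'_def
    by (intro com_rules com_scale com_mult far_t far)
      (auto simp: a_d_e_f_n_def intro: com_h_hb)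
  have t4: "t u (j - 4) = X + t u (j - 6) - c u * L"
    by (simp add: X_def t5)
  have split: "t u j = T0 + T1 - c u * X' + T2"
    unfolding t0 t1 t2 t3 s2 s4 t4 t5 T0_def T1_def T2_def
    by (simp only: distrib_left distrib_right left_diff_distrib right_diff_distrib mult.assoc
        mult_1_left mult_1_right scalar_swaps scalar_swap[of "t u (j - 6)"]
        t6[simplified, THEN lift] t6 insert_iff simp_thms) simp
  have "T0 * (Y + c u * W) = (Y - c u * W) * T0"
    unfolding T0_def using t6 by (intro intertwine_commuting) auto
  moreover have "T1 * (Y + c u * W) = (Y - c u * W) * T1"
    unfolding T1_def using comX antX by (intro intertwine_anti_ad) (auto simp: com_def ant_def)
  moreover have "(c u * X') * (Y + c u * W) = (Y - c u * W) * (c u * X')"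
    using comX' antX' by (intro intertwine_anti_adef) (auto simp: com_def ant_def)
  moreover have "T2 * (Y + c u * W) = (Y - c u * W) * T2"
  proof -
    \<comment> \<open>This is \<open>\<beta>_rec\<close> at n = j, times \<open>L\<close>. For j
      below 6 the factor h (j - 5) of \<open>L\<close> is zero.\<close>
    have "q * g * L = p * L + q * p * c ((b j)\<^sup>2) * L"
    proof (cases "6 \<le> j")
      case True
      show ?thesis
        using \<beta>_rec[OF assms True \<open>h (j + 2) \<noteq> 0\<close>]
        by (simp add: p_q_def g_def c_mult[symmetric] c_add[symmetric] distrib_right[symmetric] algebra_simps)
    next
      case False
      then show ?thesis by (simp add: L_def h_nonpos)
    qed
    then show ?thesis
      unfolding T2_def using comL antL by (intro intertwine_anti_d) (auto simp: com_def ant_def)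
  qed
  ultimately have T: "t u j * (Y + c u * W) = (Y - c u * W) * t u j"
    unfolding split by (simp only: distrib_right[of _ _ "Y + c u * W"]
      left_diff_distrib[of _ _ "Y + c u * W"] distrib_left[of "Y - c u * W"]
      right_diff_distrib[of "Y - c u * W"])
  have ham: "ham j = ham (j - 4) + a + hb (j - 1) + (d + f + e + p * a * d * e)"
    using ham_even[OF assms] ham_odd[of "j - 1"] ham_even[of "j - 2"] ham_odd[of "j - 3"] assms
    unfolding hb_eq[symmetric] by (simp add: a_d_e_f_n_def add.commute add.left_commute)
  \<comment> \<open>Besides \<open>n\<close>, \<open>Y\<close> contains only the product
    \<open>e * f\<close>, which commutes with \<open>x\<close> also when both factors anticommute
    with it.\<close>
  have comY: "com x Y" if "com x n" "ant x e \<and> ant x f \<or> com x e \<and> com x f" for x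
    unfolding Y_def mult.assoc
    using com_mult[of x "e * f" n] com_mult[of x e f] com_mult_ant[of x e f] that
    by (auto simp: mult.assoc p_q_def intro!: com_rules com_scale)
  have "com Y (ham (j - 4))"
    by (intro com_ham com_sym[OF comY]) (auto simp: a_d_e_f_n_def intro!: com_h)
  moreover have "com (hb (j - 1)) Y"
    by (rule comY) (auto simp: a_d_e_f_n_def intro: com_h_hb ant_h_hb)
  moreover have "com a Y"
    by (rule comY) (auto simp: a_d_e_f_n_def intro: com_h ant_h)
  ultimately have H: "ham j * Y - Y * ham j = 2 * W"
    using commutator_Y unfolding com_def ham by (simp add: distrib_left distrib_right)
  have "t u j * Y - Y * t u j = - (c u * (t u j * W + W * t u j))"
    using T by (simp add: algebra_simps c_left_comm[of "t u j"])
  moreover have "t u j * (2 * W) + 2 * W * t u j = 2 * (t u j * W + W * t u j)"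
    by (simp add: mult_2 distrib_left distrib_right)
  ultimately show ?thesis
    unfolding mode_def Y_eq[symmetric] H by (simp add: mult_2 distrib_left)
qed

lemma ham_by_card:
  "ham j = (\<Sum>S\<in>{S. S \<subseteq> V j \<and> indep S \<and> card S = 1}. oprod val S)"
proof -
  have "{S. S \<subseteq> V j \<and> indep S \<and> card S = 1} = (\<lambda>v. {v}) ` V j"
    by (auto simp: card_1_singleton_iff indep_def adj_irrefl)
  then show ?thesis
    by (simp add: ham_def sum.reindex oprod_def)
qed

section \<open>Removing the last clique\<close>

text \<open>The sum of the elements of the simplicial clique K of the model of size
  \<open>j\<close>; removing this clique leaves size \<open>peel j\<close>.\<close>

definition clique :: "int \<Rightarrow> 'a" where
  "clique j = (if odd j then h j else h j + h (j - 1) + hb (j + 1))"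

definition peel :: "int \<Rightarrow> int" where
  "peel j = (if odd j then j - 1 else j - 2)"

text \<open>\<open>r\<close> is the part of \<open>y\<close> commuting with \<open>x\<close>; the
  anticommuting part drops out of the anticommutator.\<close>

lemma anticommutator_split:
  assumes "com x r" "ant x (y - r)"
  shows "y * x + x * y = 2 * (x * r)"
proof -
  have "x * y - x * r = r * x - y * x" "r * x = x * r"
    using assms by (simp_all add: com_def ant_def left_diff_distrib right_diff_distrib)
  then have "y * x + x * y = x * r + x * r"
    by (simp add: algebra_simps)
  then show ?thesis
    by (simp add: mult_2)
qed

lemma t_even_peel:
  assumes "even j"
  shows "t u j = t u (j - 2) - c u * (h (j - 1) * t u (j - 4)) - c u * (h j * t u (j - 3))
      - c u * (hb (j + 1) * s u (j - 2))"
  using t_even[OF assms, of u] t_odd[of "j - 1" u] assms by simp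

lemma anticommutator_edge_even:
  assumes "even j" "\<And>i. i \<le> j - 2 \<Longrightarrow> com x (h i)" "ant x (h (j - 1))" "ant x (h j)"
  shows "t u j * x + x * t u j = 2 * (x * t u (j - 2))"
proof (rule anticommutator_split)
  have hb: "ant x (hb (j + 1))"
    unfolding hb_def mult.assoc using assms(2,4)
    by (intro ant_mult_right com_rules) auto
  have "t u j - t u (j - 2) = - (c u * (h (j - 1) * t u (j - 4))) - c u * (h j * t u (j - 3))
      - c u * (hb (j + 1) * s u (j - 2))"
    using t_even_peel[OF assms(1), of u] by simp
  then show "ant x (t u j - t u (j - 2))"
    using assms(2-4) hb
    by (auto intro!: ant_rules ant_scale ant_mult_left com_t com_s)
qed (use assms in \<open>auto intro: com_t\<close>)

text \<open>For an element v of the last clique, independent sets of the smaller graph contain at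
  most one neighbour of v, so the anticommutator keeps twice v times the polynomial of the
  non-neighbours. This and the next three lemmas cover all types of v.\<close>

lemma anticommutator_h_odd:
  assumes "odd j"
  shows "t u (j - 1) * h j + h j * t u (j - 1) = 2 * (h j * t u (j - 3))"
proof -
  have "t u (j - 1) * h j + h j * t u (j - 1) = 2 * (h j * t u (j - 1 - 2))"
    by (rule anticommutator_edge_even) (use assms in \<open>auto intro: com_h ant_h\<close>)
  then show ?thesis by simp
qed

lemma anticommutator_h_even_1:
  assumes "even j"
  shows "t u (j - 2) * h (j - 1) + h (j - 1) * t u (j - 2) = 2 * (h (j - 1) * t u (j - 4))"
proof -
  have "t u (j - 2) * h (j - 1) + h (j - 1) * t u (j - 2) = 2 * (h (j - 1) * t u (j - 2 - 2))"
    by (rule anticommutator_edge_even) (use assms in \<open>auto intro: com_h ant_h\<close>)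
  then show ?thesis by simp
qed

lemma anticommutator_h_even:
  assumes "even j"
  shows "t u (j - 2) * h j + h j * t u (j - 2) = 2 * (h j * t u (j - 3))"
proof (rule anticommutator_split)
  have "t u (j - 2) - t u (j - 3) = - (c u * (h (j - 2) * t u (j - 5))) - c u * (hb (j - 1) * s u (j - 4))"
    using t_even[of "j - 2" u] assms by simp
  then show "ant (h j) (t u (j - 2) - t u (j - 3))"
    by (auto intro!: ant_rules ant_scale ant_mult_left com_t com_s com_h ant_h ant_h_hb)
qed (auto intro!: com_t com_h)

text \<open>The commuting part is \<open>s u (j - 2)\<close>, the polynomial of the non-neighbours
  of hb (j + 1). Recursions are unfolded to exhibit every factor that commutes or anticommutes with
  it.\<close>

lemma anticommutator_hb:
  assumes "even j"
  shows "t u (j - 2) * hb (j + 1) + hb (j + 1) * t u (j - 2) = 2 * (hb (j + 1) * s u (j - 2))"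
proof (rule anticommutator_split)
  let ?x = "hb (j + 1)"
  have far: "com ?x (h i)" if "i \<le> j - 6" for i
    using that by (intro com_h_hb) auto
  have far_t: "com ?x (t u i)" "com ?x (s u i)" if "i \<le> j - 6" for i
    using that by (auto intro!: com_t com_s far)
  define X where "X = t u (j - 4) - t u (j - 5)"
  have X_eq: "X = - (c u * (h (j - 4) * t u (j - 7))) - c u * (hb (j - 3) * s u (j - 6))"
    using t_even[of "j - 4" u] assms by (simp add: X_def)
  have hb_hb: "com ?x (hb (j - 3))"
    using assms by (intro com_hb com_h_hb) auto
  have comX: "com ?x X"
    unfolding X_eq
    by (intro com_rules com_scale com_mult far_t hb_hb com_h_hb) auto
  have t5: "t u (j - 5) = t u (j - 6) - c u * (h (j - 5) * t u (j - 8))"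
    using t_odd[of "j - 5" u] assms by simp
  \<comment> \<open>The two terms with h (j - 5), which anticommutes with hb (j + 1),
    cancel.\<close>
  have s2: "s u (j - 2) = X + t u (j - 6) - c u * (h (j - 2) * t u (j - 6))"
    by (simp add: s_def X_def t5)
  show "com ?x (s u (j - 2))"
    unfolding s2 by (intro com_rules com_scale com_mult far_t com_h_hb comX) auto
  have t2: "t u (j - 2) = t u (j - 3) - c u * (h (j - 2) * t u (j - 5)) - c u * (hb (j - 1) * s u (j - 4))"
    using t_even[of "j - 2" u] assms by simp
  have t3: "t u (j - 3) = t u (j - 4) - c u * (h (j - 3) * t u (j - 6))"
    using t_odd[of "j - 3" u] assms by simp
  have "t u (j - 2) - s u (j - 2) = - (c u * (h (j - 5) * t u (j - 8)))
      - c u * (h (j - 3) * t u (j - 6)) + c u * (h (j - 2) * (c u * (h (j - 5) * t u (j - 8))))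
      - c u * (hb (j - 1) * s u (j - 4))"
    unfolding t2 t3 s2 t5 X_def by (simp add: right_diff_distrib)
  moreover have "ant ?x (hb (j - 1) * s u (j - 4))"
  proof -
    have "hb (j - 1) * s u (j - 4) = hb (j - 1) * (t u (j - 6) + c u * (h (j - 7) * t u (j - 10)))
        - c u * (hb (j - 1) * h (j - 4) * t u (j - 8))"
      by (simp add: s_def distrib_left right_diff_distrib c_left_comm[of "hb _"] mult.assoc)
    moreover have "ant ?x (hb (j - 1))"
      using ant_hb[of "j + 1"] assms by simp
    ultimately show ?thesis
      by (auto intro!: ant_rules ant_scale ant_mult_left com_rules com_scale com_mult far_t far com_h_hb)
  qed
  moreover have "ant ?x (h (j - 5) * t u (j - 8))" "ant ?x (h (j - 3) * t u (j - 6))"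
    by (auto intro!: ant_mult_left far_t ant_h_hb(2))
  moreover from this(1) have "ant ?x (h (j - 2) * (c u * (h (j - 5) * t u (j - 8))))"
    by (rule ant_mult_right[OF com_h_hb(2) ant_scale, rotated]) auto
  ultimately show "ant ?x (t u (j - 2) - s u (j - 2))"
    by (simp only: ant_rules ant_scale)
qed

text \<open>Deleting the clique elements subtracts u times each element times the polynomial of its
  non-neighbours, and these products are half the anticommutators computed above.\<close>

lemma t_peel:
  "2 * t u j = 2 * t u (peel j) - c u * (t u (peel j) * clique j + clique j * t u (peel j))"
proof (cases "odd j")
  case True
  then have "c u * (t u (j - 1) * h j + h j * t u (j - 1)) = c u * (2 * (h j * t u (j - 3)))"
    by (simp add: anticommutator_h_odd)
  then show ?thesis
    using True t_odd[OF True, of u] by (simp add: peel_def clique_def mult_2 distrib_left)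
next
  case False
  then have "even j" by simp
  have "t u (j - 2) * clique j + clique j * t u (j - 2)
      = 2 * (h j * t u (j - 3) + h (j - 1) * t u (j - 4) + hb (j + 1) * s u (j - 2))"
    unfolding distrib_left anticommutator_h_even[OF \<open>even j\<close>, symmetric]
      anticommutator_h_even_1[OF \<open>even j\<close>, symmetric] anticommutator_hb[OF \<open>even j\<close>, symmetric]
    using False by (simp add: clique_def algebra_simps)
  then show ?thesis
    using False t_even_peel[OF \<open>even j\<close>, of u]
    by (simp add: peel_def mult_2 distrib_left)
qed

lemma ham_peel: "ham j = ham (peel j) + clique j"
  using ham_odd[of j] ham_even[of j] ham_odd[of "j - 1"] by (simp add: peel_def clique_def)

text \<open>The elements of the clique anticommute pairwise and have scalar squares, so the mixed
  terms cancel.\<close>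

lemma clique_sq: "\<exists>k. clique j * clique j = c k"
proof (cases "odd j")
  case False
  have "ant (h j) (h (j - 1))" "ant (h j) (hb (j + 1))" "ant (h (j - 1)) (hb (j + 1))"
    by (auto intro: ant_h ant_h_hb)
  then have "clique j * clique j = h j * h j + h (j - 1) * h (j - 1) + hb (j + 1) * hb (j + 1)"
    using False by (simp add: clique_def ant_def distrib_left distrib_right)
  moreover have "\<exists>k. hb (j + 1) * hb (j + 1) = c k"
  proof -
    let ?p = "h (j - 2) * (h (j - 3) * h j)"
    have "ant (h (j - 2)) (h (j - 3))" "ant (h (j - 2)) (h j)" "com (h (j - 3)) (h j)"
      by (auto intro: ant_h com_h)
    then have "?p * ?p = (h (j - 2) * h (j - 2)) * ((h (j - 3) * h (j - 3)) * (h j * h j))"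
      unfolding ant_def com_def
      by (metis (no_types) mult.assoc mult_minus_left mult_minus_right minus_minus)
    also have "\<dots> = c ((b (j - 2))\<^sup>2 * ((b (j - 3))\<^sup>2 * (b j)\<^sup>2))"
      by (simp add: h_sq c_mult)
    finally have "?p * ?p = \<dots>" .
    moreover have "hb (j + 1) * hb (j + 1) = c (\<beta> (j - 1)) * c (\<beta> (j - 1)) * (?p * ?p)"
      by (simp add: hb_def mult.assoc c_left_comm[of "h _"] c_left_comm[of ?p])
    ultimately show ?thesis
      by (metis c_mult)
  qed
  ultimately show ?thesis
    by (metis c_add h_sq)
qed (auto simp: clique_def h_sq)

lemma com_clique_anticommutator: "com (clique j) (x * clique j + clique j * x)"
proof -
  obtain k where k: "clique j * clique j = c k"
    using clique_sq by blast
  have "x * clique j * clique j = clique j * (clique j * x)"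
    unfolding mult.assoc[symmetric] k unfolding mult.assoc k by (simp add: c_comm[of k x])
  then show ?thesis
    by (simp add: com_def distrib_left distrib_right mult.assoc)
qed

text \<open>With S = {A, K}, moving \<open>x\<close> past T only flips the sign of the S term, and
  [H, x] = 2 K x. In T K x + K x T the S terms cancel because S commutes with K, leaving S x, which
  matches 2 (T x - x T) up to the factor -2u.\<close>

lemma mode_edge:
  assumes "\<And>i. i \<le> peel j \<Longrightarrow> com x (h i)" "ant x (clique j)"
  shows "mode u j x"
proof -
  define K A T where "K = clique j" and "A = t u (peel j)" and "T = t u j"
  define S where "S = A * K + K * A"
  have A: "x * A = A * x"
    using com_t[OF assms(1)] by (simp add: A_def com_def)
  have K: "x * K = - (K * x)"
    using assms(2) by (simp add: K_def ant_def)
  have S: "x * S = - (S * x)"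
    using ant_rules(2)[OF ant_mult_right ant_mult_left, of x A K K A] A K
    by (simp add: S_def com_def ant_def)
  have T: "2 * T = 2 * A - c u * S"
    unfolding T_def A_def K_def S_def by (rule t_peel)
  have H: "ham j * x - x * ham j = 2 * (K * x)"
    using com_ham[OF assms(1)] K
    by (simp add: ham_peel[of j] com_def mult_2 distrib_left distrib_right flip: K_def)
  have Tx: "2 * (T * x) = 2 * (A * x) - c u * (S * x)"
    using arg_cong[OF T, of "\<lambda>y. y * x"] by (simp add: left_diff_distrib mult.assoc)
  have xT: "2 * (x * T) = 2 * (A * x) + c u * (S * x)"
    using arg_cong[OF T, of "\<lambda>y. x * y"] A S
    by (simp add: mult_2 distrib_left right_diff_distrib c_left_comm[of x])
  have KS: "S * (K * x) = K * (S * x)"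
    using com_clique_anticommutator[of j A]
    by (simp add: com_def mult.assoc[symmetric] flip: K_def S_def)
  have "2 * (T * (K * x) + K * x * T) = (2 * T) * (K * x) + K * (2 * (x * T))"
    by (simp add: mult_2 distrib_left distrib_right mult.assoc)
  also have "\<dots> = 2 * (A * (K * x)) - c u * (S * (K * x)) + (2 * (K * (A * x)) + c u * (K * (S * x)))"
    unfolding xT T by (simp add: mult_2 distrib_left distrib_right left_diff_distrib mult.assoc
      c_left_comm[of K])
  also have "\<dots> = 2 * (S * x)"
    unfolding KS unfolding S_def by (simp add: mult_2 distrib_left distrib_right mult.assoc)
  finally have TK: "T * (K * x) + K * x * T = S * x"
    by (rule two_mult_cancel)
  have "2 * (T * x - x * T) = - (c u * (2 * (S * x)))"
    using Tx xT by (simp add: mult_2 right_diff_distrib distrib_left)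
  also have "2 * (S * x) = T * (2 * (K * x)) + 2 * (K * x) * T"
    unfolding TK[symmetric] by (simp add: mult_2 distrib_left distrib_right)
  finally show ?thesis
    unfolding mode_def H T_def .
qed

text \<open>For odd \<open>j\<close>, and for h (j - 1) when \<open>j\<close> is even, the element
  sits at the edge of the smaller chain and \<open>mode_edge\<close> applies; h j + hb (j + 1) is
  the case of \<open>mode_clique\<close>.\<close>

lemma mode_clique_peel: "mode u (peel j) (clique j)"
proof (cases "odd j")
  case True
  show ?thesis
  proof (rule mode_edge)
    show "ant (clique j) (clique (peel j))"
      using True by (auto simp: clique_def peel_def intro!: ant_rules ant_h ant_h_hb)
  qed (use True in \<open>auto simp: clique_def peel_def intro!: com_h\<close>)
next
  case False
  have "mode u (j - 2) (h (j - 1))"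
  proof (rule mode_edge)
    show "ant (h (j - 1)) (clique (j - 2))"
      using False by (auto simp: clique_def peel_def intro!: ant_rules ant_h ant_h_hb)
  qed (use False in \<open>auto simp: clique_def peel_def intro!: com_h\<close>)
  moreover have "mode u (j - 2) (h j + hb (j + 1))"
    using mode_clique[of "j - 2" u] False by (simp add: add.commute)
  ultimately have "mode u (j - 2) (h (j - 1) + (h j + hb (j + 1)))"
    by (rule mode_add)
  then show ?thesis
    using False by (simp add: clique_def peel_def ac_simps)
qed

section \<open>Conservation of the transfer matrix and degree bounds\<close>

text \<open>Let H, A belong to the peeled chain. As H commutes with A and K with S, twice the
  commutator is 2 [K, A] - u [H, S]. Since [H, S] = {A, [H, K]}, this vanishes by the intertwining
  relation for K.\<close>

lemma com_ham_t: "com (ham j) (t u j)"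
proof (induction "nat j" arbitrary: j rule: less_induct)
  case less
  show ?case
  proof (cases "1 \<le> j")
    case False
    then show ?thesis by (simp add: ham_nonpos com_def)
  next
    case True
    define H K A where "H = ham (peel j)" and "K = clique j" and "A = t u (peel j)"
    define S D where "S = A * K + K * A" and "D = H * K - K * H"
    have IH: "H * A = A * H"
      using less True by (auto simp: H_def A_def peel_def com_def)
    have KS: "K * S = S * K"
      using com_clique_anticommutator[of j A] by (simp add: K_def S_def com_def)
    have mode: "2 * (A * K - K * A) = - (c u * (A * D + D * A))"
      using mode_clique_peel[of u j] unfolding mode_def A_def K_def D_def H_def .
    have "A * D + D * A = H * S - S * H"
    proof -
      have "H * (A * K) = A * (H * K)" "K * (A * H) = K * (H * A)"
        by (metis IH mult.assoc) (simp add: IH)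
      then show ?thesis
        by (simp add: S_def D_def distrib_left distrib_right left_diff_distrib right_diff_distrib
          mult.assoc)
    qed
    with mode have *: "2 * (A * K) - 2 * (K * A) = c u * (S * H) - c u * (H * S)"
      by (simp add: right_diff_distrib)
    have T: "2 * t u j = 2 * A - c u * S"
      unfolding A_def K_def S_def by (rule t_peel)
    have ham: "ham j = H + K"
      unfolding H_def K_def by (rule ham_peel)
    have "2 * (ham j * t u j) = (H + K) * (2 * A - c u * S)"
      unfolding T[symmetric] ham by (simp add: mult_2 distrib_left distrib_right)
    also have "\<dots> = 2 * (A * H) + 2 * (K * A) - c u * (H * S) - c u * (S * K)"
      by (simp add: IH KS mult_2 distrib_left distrib_right right_diff_distrib
        c_left_comm[of H] c_left_comm[of K])
    also have "\<dots> = 2 * (A * H) + 2 * (A * K) - c u * (S * H) - c u * (S * K)"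
      using * by (simp add: algebra_simps)
    also have "\<dots> = (2 * A - c u * S) * (H + K)"
      by (simp add: mult_2 distrib_left distrib_right left_diff_distrib mult.assoc)
    also have "\<dots> = 2 * (t u j * ham j)"
      unfolding T[symmetric] ham mult.assoc ..
    finally show ?thesis
      unfolding com_def by (rule two_mult_cancel)
  qed
qed

text \<open>Each further power of u lowers the size by at least three: the \<open>h\<close> terms
  pass to t (j - 3), and in the \<open>hb\<close> term \<open>s u (j - 2)\<close> has degree at most
  (j - 1) div 3.\<close>

lemma poly_fun_t: "poly_fun (nat ((j + 2) div 3)) (\<lambda>u. t u j)"
proof (induction "nat j" arbitrary: j rule: less_induct)
  case less
  show ?case
  proof (cases "1 \<le> j")
    case False
    then show ?thesis
      by (simp add: t_nonpos poly_fun_const)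
  next
    case True
    let ?d = "nat ((j + 2) div 3)"
    have t: "poly_fun d (\<lambda>u. t u i)" if "i < j" "nat ((i + 2) div 3) \<le> d" for i d
      using less[of i] that True by (intro poly_fun_mono[OF _ that(2)]) auto
    have ht: "poly_fun d (\<lambda>u. c u * (x * t u i))"
      if "i < j" "1 \<le> d" "nat ((i + 2) div 3) \<le> d - 1" for i d x
      using poly_fun_scale[OF poly_fun_mult_left[OF t[OF that(1,3)], of x]] that(2) by simp
    have 1: "poly_fun ?d (\<lambda>u. t u (j - 1))" "poly_fun ?d (\<lambda>u. c u * (h j * t u (j - 3)))"
      using True by (intro t ht; simp; linarith?)+
    show ?thesis
    proof (cases "odd j")
      case True
      show ?thesis
        unfolding t_odd[OF True] by (intro poly_fun_diff 1)
    next
      case False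
      then have "even j" by simp
      have "poly_fun ?d (\<lambda>u. c u * (hb (j + 1) * s u (j - 2)))"
      proof (cases "4 \<le> j")
        case False
        then show ?thesis by (simp add: hb_small poly_fun_const)
      next
        case True
        let ?e = "nat ((j - 1) div 3)"
        have "poly_fun ?e (\<lambda>u. t u (j - 4))" "poly_fun ?e (\<lambda>u. c u * (h (j - 2) * t u (j - 6)))"
          using True by (intro t ht; simp; linarith?)+
        moreover have "poly_fun ?e (\<lambda>u. c u * (h (j - 5) * t u (j - 8)))"
        proof (cases "6 \<le> j")
          case True
          then show ?thesis by (intro ht; simp; linarith?)
        qed (simp add: h_nonpos poly_fun_const)
        ultimately have "poly_fun ?e (\<lambda>u. s u (j - 2))"
          unfolding s_def by (intro poly_fun_add poly_fun_diff) simp_all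
        moreover have "Suc ?e = ?d"
          using True by (simp add: nat_div_distrib)
        ultimately show ?thesis
          by (metis poly_fun_scale poly_fun_mult_left)
      qed
      then show ?thesis
        unfolding t_even[OF \<open>even j\<close>] by (intro poly_fun_diff 1)
    qed
  qed
qed

lemma t_0: "t 0 j = 1"
proof (induction "nat j" arbitrary: j rule: less_induct)
  case less
  show ?case
  proof (cases "1 \<le> j")
    case False
    then show ?thesis by (simp add: t_nonpos)
  next
    case True
    then have "t 0 (j - 1) = 1" using less by simp
    then show ?thesis
      using t_odd[of j 0] t_even[of j 0] by (cases "odd j") simp_all
  qed
qed

text \<open>The left side has degree at most 2S in u, where S = (j + 2) div 3, and the substitution
  of u^2 doubles the degree of \<open>P\<close>.\<close>

lemma degree_t_norm:
  assumes "\<And>u. t u j * t (- u) j = c (poly P (u\<^sup>2))"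
  shows "degree P \<le> nat ((j + 2) div 3)"
proof -
  let ?S = "nat ((j + 2) div 3)" and ?Q = "pcompose P [:0, 0, 1:]"
  have "poly_fun (?S + ?S) (\<lambda>u. t u j * t (- u) j)"
    by (intro poly_fun_mult poly_fun_t poly_fun_uminus[of _ "\<lambda>u. t u j"])
  moreover have "t u j * t (- u) j = c (poly ?Q u)" for u
    by (simp add: assms poly_pcompose power2_eq_square)
  ultimately have "degree ?Q \<le> ?S + ?S"
    by (intro degree_le_of_poly_fun) simp
  then show ?thesis
    by (simp add: degree_pcompose)
qed

end


section \<open>Eigenmodes\<close>

text \<open>At a multiple root x, the quotient by X - x would still vanish on all of
  \<open>A\<close> while having smaller degree than the number of elements of
  \<open>A\<close>.\<close>

lemma poly_pderiv_nonzero_of_roots: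
  fixes p :: "'b::{idom, ring_char_0} poly"
  assumes "p \<noteq> 0" "finite A" "\<And>x. x \<in> A \<Longrightarrow> poly p x = 0" "degree p \<le> card A" "x \<in> A"
  shows "poly (pderiv p) x \<noteq> 0"
proof
  assume 0: "poly (pderiv p) x = 0"
  obtain q where q: "p = [:- x, 1:] * q"
    using assms(3,5) by (metis dvdE poly_eq_0_iff_dvd)
  have "poly (pderiv p) x = poly q x"
    unfolding q by (simp add: pderiv_mult pderiv_pCons del: mult_pCons_left)
  with 0 have "poly q y = 0" if "y \<in> A" for y
    using assms(3)[OF that] by (cases "y = x") (auto simp: q simp del: mult_pCons_left)
  then have sub: "A \<subseteq> {y. poly q y = 0}" by auto
  have "q \<noteq> 0" using assms(1) q by fastforce
  have "card A \<le> card {y. poly q y = 0}"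
    by (rule card_mono[OF poly_roots_finite[OF \<open>q \<noteq> 0\<close>] sub])
  also have "\<dots> \<le> degree q"
    by (rule card_poly_roots_bound[OF \<open>q \<noteq> 0\<close>])
  finally have "card A \<le> degree q" .
  moreover have "degree p = Suc (degree q)"
    unfolding q using \<open>q \<noteq> 0\<close> by (subst degree_mult_eq) auto
  ultimately show False
    using assms(4) by simp
qed

text \<open>\<open>P'\<close> is the polynomial of the peeled chain; the derivative is always
  written \<open>pderiv P\<close>.\<close>

locale edge_mode = claw_chain c h b \<beta>
  for c :: "complex \<Rightarrow> 'a::ring_1" and h b \<beta> +
  fixes j :: int and x :: 'a and P P' :: "complex poly"
  assumes com_x: "\<And>i. i \<le> peel j \<Longrightarrow> com x (h i)"
    and ant_x: "ant x (clique j)"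
    and x_sq: "x * x = 1"
    and norm: "\<And>v. t v j * t (- v) j = c (poly P (v\<^sup>2))"
    and norm_peel: "\<And>v. t v (peel j) * t (- v) (peel j) = c (poly P' (v\<^sup>2))"
begin

definition C :: "complex \<Rightarrow> 'a" where
  "C v = t (- v) j * x * t v j"

definition ad :: "'a \<Rightarrow> 'a" where
  "ad y = ham j * y - y * ham j"

lemma norm': "t (- v) j * t v j = c (poly P (v\<^sup>2))"
  using norm[of "- v"] by simp

lemma ham_t: "ham j * t v j = t v j * ham j"
  using com_ham_t[of j v] by (simp add: com_def)

text \<open>In the diagonal picture this says that conjugation by the transfer matrix acts on the span of
  the modes as the Cayley transform of (v / 2) ad.\<close>
lemma C_cayley: "2 * C v - c v * ad (C v) = c (poly P (v\<^sup>2)) * (2 * x + c v * ad x)"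
proof -
  define T T' D where "T = t v j" and "T' = t (- v) j" and "D = ad x"
  \<comment> \<open>The intertwining relation at -v; multiplied by T on the right it lets T' T be
    replaced by the scalar P(v^2).\<close>
  have "2 * (T' * x - x * T') = c v * (T' * D + D * T')"
    using mode_edge[OF com_x ant_x, of "- v"] unfolding mode_def T'_def D_def ad_def
    by (simp add: c_minus)
  then have "2 * (T' * x - x * T') * T = c v * (T' * D + D * T') * T"
    by simp
  moreover have "2 * (T' * x - x * T') * T = 2 * C v - c (poly P (v\<^sup>2)) * (2 * x)"
  proof -
    have "x * (T' * T) = c (poly P (v\<^sup>2)) * x"
      by (simp add: T'_def T_def norm' c_comm[of _ x])
    then show ?thesis
      by (simp add: C_def T'_def T_def mult_2 distrib_left distrib_right left_diff_distrib
          right_diff_distrib mult.assoc)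
  qed
  moreover have "c v * (T' * D + D * T') * T = c v * ad (C v) + c (poly P (v\<^sup>2)) * (c v * D)"
  proof -
    have "T' * D * T = ad (C v)"
    proof -
      have "ham j * (T' * (x * T)) = T' * (ham j * (x * T))"
        unfolding T'_def by (metis ham_t mult.assoc)
      moreover have "x * (ham j * T) = x * (T * ham j)"
        by (simp add: T_def ham_t)
      ultimately show ?thesis
        by (simp add: ad_def D_def C_def left_diff_distrib right_diff_distrib mult.assoc flip: T_def T'_def)
    qed
    moreover have "D * (T' * T) = c (poly P (v\<^sup>2)) * D"
      by (simp add: T'_def T_def norm' c_comm[of _ D])
    ultimately show ?thesis
      by (simp add: distrib_left distrib_right mult.assoc c_left_comm[of "c v"])
  qed
  ultimately have "2 * C v - c (poly P (v\<^sup>2)) * (2 * x) = c v * ad (C v) + c (poly P (v\<^sup>2)) * (c v * D)"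
    by simp
  then show ?thesis
    unfolding distrib_left D_def by (simp add: diff_eq_eq add.commute add.left_commute diff_add_eq)
qed

text \<open>The right side of \<open>C_cayley\<close> vanishes at a root.\<close>

lemma C_eigen:
  assumes "u \<noteq> 0" "poly P (u\<^sup>2) = 0"
  shows "ad (C u) = c (2 / u) * C u"
proof -
  have "c u * ad (C u) = 2 * C u"
    using C_cayley[of u] assms(2) by simp
  also have "\<dots> = c u * (c (2 / u) * C u)"
    using assms(1) by (simp add: mult.assoc[symmetric] c_mult[symmetric] c_2)
  finally show ?thesis
    using assms(1) by (rule c_mult_cancel)
qed

lemma anticommutator_t: "t v j * x + x * t v j = 2 * (x * t v (peel j))"
proof -
  define S where "S = t v (peel j) * clique j + clique j * t v (peel j)"
  have A: "com x (t v (peel j))"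
    using com_x by (rule com_t)
  have S: "S * x = - (x * S)"
    using ant_rules(2)[OF ant_mult_right ant_mult_left] A ant_x
    by (simp add: S_def ant_def)
  have T: "2 * t v j = 2 * t v (peel j) - c v * S"
    unfolding S_def by (rule t_peel)
  have "2 * (t v j * x + x * t v j) = (2 * t v j) * x + x * (2 * t v j)"
    by (simp add: mult_2 distrib_left distrib_right)
  also have "\<dots> = 2 * (2 * (x * t v (peel j)))"
    unfolding T using A S
    by (simp add: com_def mult_2 distrib_left distrib_right left_diff_distrib right_diff_distrib
      mult.assoc c_left_comm[of x])
  finally show ?thesis
    by (rule two_mult_cancel)
qed

text \<open>Moving \<open>x\<close> through the neighbouring transfer matrix by
  \<open>anticommutator_t\<close> leaves products of T with A' and of T' with A, which combine to a
  scalar.\<close>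

lemma anticommutator_C_x:
  "C v * x + x * C v = c (4 * poly P' (v\<^sup>2) - 2 * poly P (v\<^sup>2))"
proof -
  define T T' A A' K where "T = t v j" and "T' = t (- v) j" and "A = t v (peel j)"
    and "A' = t (- v) (peel j)" and "K = clique j"
  have A: "x * A = A * x" "x * A' = A' * x"
    using com_t[OF com_x] by (auto simp: A_def A'_def com_def)
  have x_xl: "x * (x * y) = y" for y
    by (simp add: x_sq flip: mult.assoc)
  have x_A': "x * (A' * (x * y)) = A' * y" for y
    by (metis A(2) mult.assoc x_sq mult_1_left)
  have TT: "T' * T = c (poly P (v\<^sup>2))"
    by (simp add: T_def T'_def norm')
  have AA: "A' * A = c (poly P' (v\<^sup>2))" "A * A' = c (poly P' (v\<^sup>2))"
    using norm_peel[of "- v"] norm_peel[of v] by (simp_all add: A_def A'_def)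
  have xT: "x * T = 2 * (x * A) - T * x" and xT': "x * T' = 2 * (x * A') - T' * x"
    using anticommutator_t[of v] anticommutator_t[of "- v"]
    by (simp_all add: T_def T'_def A_def A'_def algebra_simps)
  have "C v * x + x * C v = T' * (x * T) * x + (x * T') * x * T"
    by (simp add: C_def T_def T'_def mult.assoc)
  also have "T' * (x * T) * x = 2 * (T' * A) - T' * T"
    unfolding xT using A by (simp add: mult_2 distrib_left right_diff_distrib left_diff_distrib
      distrib_right mult.assoc x_sq)
  also have "(x * T') * x * T = 2 * (A' * T) - T' * T"
    unfolding xT' using x_A' by (simp add: mult_2 left_diff_distrib distrib_right x_xl mult.assoc)
  also have "2 * (T' * A) - T' * T + (2 * (A' * T) - T' * T)
      = (2 * T') * A + A' * (2 * T) - 2 * (T' * T)"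
    by (simp add: mult_2 distrib_left distrib_right)
  \<comment> \<open>After expansion by \<open>t_peel\<close> the terms linear in \<open>v\<close>
    form the commutator of K with A' A, which is zero because A' A is a scalar.\<close>
  also have "(2 * T') * A + A' * (2 * T) = 2 * (2 * (A' * A))"
  proof -
    have "2 * T = 2 * A - c v * (A * K + K * A)" "2 * T' = 2 * A' + c v * (A' * K + K * A')"
      using t_peel[of v j] t_peel[of "- v" j]
      by (simp_all add: T_def T'_def A_def A'_def K_def c_minus)
    moreover have "A' * (A * K) = K * (A' * A)"
      by (simp add: AA c_comm[of _ K] flip: mult.assoc)
    ultimately show ?thesis
      by (simp add: distrib_left distrib_right right_diff_distrib mult.assoc c_left_comm[of A']
        mult_2)
  qed
  finally show ?thesis
    unfolding TT AA c_2[symmetric] c_mult[symmetric] c_diff[symmetric] by simp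
qed

lemma anticommutator_C:
  assumes "u \<noteq> 0" "poly P (u\<^sup>2) = 0" "poly P (v\<^sup>2) = 0"
  shows "C u * C v + C v * C u =
    c (if v = - u then 16 * (poly P' (u\<^sup>2) * (- u\<^sup>2 * poly (pderiv P) (u\<^sup>2))) else 0)"
proof -
  define l G Q where "l = 4 * poly P' (u\<^sup>2)" and "G v = C u * C v + C v * C u"
    and "Q = pcompose P [:0, 0, 1:]" for v
  have Q: "poly Q v = poly P (v\<^sup>2)" for v
    by (simp add: Q_def poly_pcompose power2_eq_square)
  have Cx: "C u * x + x * C u = c l"
    using anticommutator_C_x[of u] assms(2) by (simp add: l_def)
  define B where "B y = C u * y + y * C u" for y
  have B: "B (2 * y) = 2 * B y" "B (y - z) = B y - B z" "B (y + z) = B y + B z" "B (c a * y) = c a * B y"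
    for y z a
    by (simp_all add: B_def mult_2 distrib_left distrib_right left_diff_distrib right_diff_distrib
      c_left_comm[of "C u"] mult.assoc)
  \<comment> \<open>Leibniz rule for \<open>ad\<close>, with \<open>C u\<close> an eigenvector of
    eigenvalue 2 / u.\<close>
  have B_ad: "B (ad y) = ad (B y) - c (2 / u) * B y" for y
  proof -
    have "B (ad y) = ad (B y) - (ad (C u) * y + y * ad (C u))"
      by (simp add: B_def ad_def algebra_simps)
    then show ?thesis
      unfolding C_eigen[OF assms(1,2)]
      by (simp add: B_def distrib_left mult.assoc c_left_comm[of y])
  qed
  have ad_c: "ad (c a) = 0" for a
    by (simp add: ad_def c_comm[of a])
  have G_B: "G v = B (C v)" for v
    by (simp add: G_def B_def)
  \<comment> \<open>The anticommutator with \<open>C u\<close> applied to both sides of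
    \<open>C_cayley\<close>; on the right {C u, x} is the scalar \<open>l\<close>, which
    \<open>ad\<close> kills.\<close>
  have G: "c 2 * G v + c v * (c (2 / u) * G v - ad (G v)) = c (poly (Q * [:2 * l, - 2 * l / u:]) v)" for v
  proof -
    have "B (2 * C v - c v * ad (C v)) = c 2 * G v + c v * (c (2 / u) * G v - ad (G v))"
      unfolding B B_ad G_B c_2 by (simp add: right_diff_distrib)
    moreover have "B (2 * C v - c v * ad (C v)) = c (poly P (v\<^sup>2)) * (2 * c l + c v * - (c (2 / u) * c l))"
      unfolding C_cayley B B_ad Cx[folded B_def] ad_c by simp
    moreover have "\<dots> = c (poly (Q * [:2 * l, - 2 * l / u:]) v)"
      unfolding c_2[symmetric] c_mult[symmetric] c_minus[symmetric] c_add[symmetric]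
      by (simp add: Q algebra_simps)
    ultimately show ?thesis by simp
  qed
  have "\<exists>d. poly_fun d G"
  proof
    let ?S = "nat ((j + 2) div 3)"
    have "poly_fun (?S + 0 + ?S) C"
      unfolding C_def
      by (intro poly_fun_mult poly_fun_t poly_fun_uminus[of _ "\<lambda>u. t u j"] poly_fun_const)
    then show "poly_fun (?S + 0 + ?S) G"
      unfolding G_def by (intro poly_fun_add poly_fun_mult_left poly_fun_mult_right)
  qed
  then obtain g where g: "G v = c (poly g v)" for v
    using scalar_solution[OF _ G[unfolded ad_def]] by blast
  have "poly ([:2, 2 / u:] * g) v = poly (Q * [:2 * l, - 2 * l / u:]) v" for v
  proof -
    have "c (2 * poly g v + v * (2 / u * poly g v)) = c (poly (Q * [:2 * l, - 2 * l / u:]) v)"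
      using G[of v] unfolding g ad_c by (simp only: c_add c_mult diff_0_right)
    then show ?thesis
      unfolding c_eq_iff by (simp add: algebra_simps)
  qed
  then have eq: "[:2, 2 / u:] * g = Q * [:2 * l, - 2 * l / u:]"
    by (simp add: poly_eq_poly_eq_iff[symmetric] fun_eq_iff)
  show ?thesis
  proof (cases "v = - u")
    case False
    have "poly [:2, 2 / u:] v * poly g v = poly Q v * poly [:2 * l, - 2 * l / u:] v"
      by (simp only: eq flip: poly_mult)
    then have "poly [:2, 2 / u:] v * poly g v = 0"
      using assms(3) by (simp only: Q mult_zero_left)
    \<comment> \<open>The only zero of the factor 2 + 2v/u is v = -u.\<close>
    moreover have "poly [:2, 2 / u:] v \<noteq> 0"
    proof
      assume "poly [:2, 2 / u:] v = 0"
      then have "2 * (u + v) = 0"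
        using assms(1) by (simp add: field_simps)
      then have "v + u = 0"
        unfolding mult_eq_0_iff by (simp add: add.commute)
      then have "v = - u"
        by (simp only: eq_neg_iff_add_eq_0)
      with False show False by simp
    qed
    ultimately have "poly g v = 0" by simp
    with False g[of v] show ?thesis by (simp add: G_def)
  next
    case True
    have Q': "poly (pderiv Q) (- u) = - 2 * u * poly (pderiv P) (u\<^sup>2)"
      by (simp add: Q_def pderiv_pcompose poly_pcompose pderiv_pCons power2_eq_square)
    \<comment> \<open>Both sides of \<open>eq\<close> vanish at -u, so the value of \<open>g\<close>
      there is obtained by comparing first derivatives.\<close>
    have "poly (pderiv ([:2, 2 / u:] * g)) (- u) = poly (pderiv (Q * [:2 * l, - 2 * l / u:])) (- u)"
      by (simp only: eq)
    then have "2 / u * poly g (- u) = - 2 * u * poly (pderiv P) (u\<^sup>2) * (4 * l)"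
      unfolding pderiv_mult poly_add poly_mult Q Q' using assms(1,2)
      by (simp add: pderiv_pCons ac_simps)
    then have "poly g (- u) = 16 * (poly P' (u\<^sup>2) * (- u\<^sup>2 * poly (pderiv P) (u\<^sup>2)))"
      using assms(1) by (simp add: l_def field_simps power2_eq_square)
    with True g[of v] show ?thesis by (simp add: G_def)
  qed
qed

end


section \<open>The concrete model\<close>

text \<open>Outside 1..M an index makes both products zero; within it the hypotheses cover i < l and
  symmetry gives the rest.\<close>

lemma hx_swap:
  fixes h :: "nat \<Rightarrow> 'a::ring"
  assumes hanti: "\<forall>m l. 1 \<le> m \<and> l \<le> M \<and> (l = m + 1 \<or> l = m + 2) \<longrightarrow> h m * h l = - (h l * h m)"
    and hcomm: "\<forall>m l. 1 \<le> m \<and> l \<le> M \<and> m + 2 < l \<longrightarrow> h m * h l = h l * h m"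
  shows "\<bar>i - l\<bar> \<in> {1, 2} \<Longrightarrow> hx M h i * hx M h l = - (hx M h l * hx M h i)"
    and "\<bar>i - l\<bar> > 2 \<Longrightarrow> hx M h i * hx M h l = hx M h l * hx M h i"
proof -
  have less: "hx M h i * hx M h l = (if l - i \<le> 2 then - (hx M h l * hx M h i) else hx M h l * hx M h i)"
    if "i < l" for i l
  proof (cases "1 \<le> i \<and> l \<le> int M")
    case True
    define m k where "m = nat i" and "k = nat l"
    have mk: "i = int m" "l = int k" "1 \<le> m" "k \<le> M" "m < k"
      using True that by (auto simp: m_def k_def)
    show ?thesis
    proof (cases "l - i \<le> 2")
      case True
      then have "k = m + 1 \<or> k = m + 2" using mk by linarith
      with hanti mk True show ?thesis by (simp add: hx_def)
    next
      case False
      then have "m + 2 < k" using mk by linarith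
      with hcomm mk False show ?thesis by (simp add: hx_def)
    qed
  qed (auto simp: hx_def)
  show "hx M h i * hx M h l = - (hx M h l * hx M h i)" if "\<bar>i - l\<bar> \<in> {1, 2}"
    using less[of i l] less[of l i] that by (cases "i < l") auto
  show "hx M h i * hx M h l = hx M h l * hx M h i" if "\<bar>i - l\<bar> > 2"
    using less[of i l] less[of l i] that by (cases "i < l") auto
qed

text \<open>\<open>betaf\<close> at m is beta_(2m+1), so this is the recursion for beta_(2n+7) with
  its denominator cleared.\<close>

lemma betaf_rec:
  assumes "betaden bb b3 b5 n \<noteq> 0"
  shows "betaf bb b3 b5 (n + 3) * (1 + (bb (2 * int n + 2))\<^sup>2 * betaf bb b3 b5 (n + 1)) =
    betaf bb b3 b5 (n + 2) * (1 + (bb (2 * int n + 6))\<^sup>2 * betaf bb b3 b5 (n + 3))"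
proof -
  have "betaf bb b3 b5 (n + 3) * betaden bb b3 b5 n = betaf bb b3 b5 (n + 2)"
    using assms by (simp add: betaden_def numeral_3_eq_3)
  then show ?thesis
    by (simp add: betaden_def algebra_simps)
qed

theorem mainTheorem10:
  fixes c :: "complex \<Rightarrow> 'a::ring_1" and M :: nat and h :: "nat \<Rightarrow> 'a"
    and b :: "nat \<Rightarrow> complex" and b3 b5 :: complex and chi :: 'a
    and P :: "nat \<Rightarrow> complex poly" and z u N :: "nat \<Rightarrow> complex"
  assumes alg: "cemb c"
    and M1: "M \<ge> 1"
    and hsq: "\<forall>m. 1 \<le> m \<and> m \<le> M \<longrightarrow> h m * h m = c ((b m)\<^sup>2)"
    and hanti: "\<forall>m l. 1 \<le> m \<and> l \<le> M \<and> (l = m + 1 \<or> l = m + 2) \<longrightarrow> h m * h l = - (h l * h m)"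
    and hcomm: "\<forall>m l. 1 \<le> m \<and> l \<le> M \<and> m + 2 < l \<longrightarrow> h m * h l = h l * h m"
    and den: "\<forall>n. 2 * (n + 3) \<le> M \<longrightarrow> betaden (hx M b) b3 b5 n \<noteq> 0"
    and Pdef: "\<forall>j \<le> M. \<forall>v. Tm c M h b b3 b5 j v * Tm c M h b b3 b5 j (- v) = c (poly (P j) (v\<^sup>2))"
    and chisq: "chi * chi = 1"
    and chi_even: "even M \<longrightarrow> chi * h M = - (h M * chi) \<and> chi * h (M - 1) = - (h (M - 1) * chi)
                      \<and> (\<forall>l. 1 \<le> l \<and> l < M - 1 \<longrightarrow> chi * h l = h l * chi)"
    and chi_odd: "odd M \<longrightarrow> chi * h M = - (h M * chi)
                      \<and> (\<forall>l. 1 \<le> l \<and> l < M \<longrightarrow> chi * h l = h l * chi)"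
    and zdist: "inj_on z {1..(M + 2) div 3}"
    and zroot: "\<forall>k \<in> {1..(M + 2) div 3}. poly (P M) (z k) = 0"
    and znz: "\<forall>k \<in> {1..(M + 2) div 3}. poly (P (M - (if odd M then 1 else 2))) (z k) \<noteq> 0"
    and usq: "\<forall>k \<in> {1..(M + 2) div 3}. (u k)\<^sup>2 = z k"
    and Nsq: "\<forall>k \<in> {1..(M + 2) div 3}. (N k)\<^sup>2 =
               16 * (poly (P (M - (if odd M then 1 else 2))) ((u k)\<^sup>2)
                     * (- (u k)\<^sup>2 * poly (pderiv (P M)) ((u k)\<^sup>2)))"
  shows "\<forall>k \<in> {k::int. k \<noteq> 0 \<and> \<bar>k\<bar> \<le> int ((M + 2) div 3)}.
         \<forall>k' \<in> {k::int. k \<noteq> 0 \<and> \<bar>k\<bar> \<le> int ((M + 2) div 3)}.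
           Qch c M h b b3 b5 M 1 * Psi c M h b b3 b5 chi u N k
             - Psi c M h b b3 b5 chi u N k * Qch c M h b b3 b5 M 1
             = c (2 * (1 / us u k)) * Psi c M h b b3 b5 chi u N k
         \<and> Psi c M h b b3 b5 chi u N k * Psi c M h b b3 b5 chi u N k'
             + Psi c M h b b3 b5 chi u N k' * Psi c M h b b3 b5 chi u N k
             = (if k + k' = 0 then 1 else 0)"
proof -
  define B where "B p = betaf (hx M b) b3 b5 (nat ((p - 1) div 2))" for p
  interpret claw_chain c "hx M h" "hx M b" B
  proof
    show "cemb c" by (fact alg)
    show "hx M h i * hx M h i = c ((hx M b i)\<^sup>2)" for i
    proof -
      have "c 0 = 0"
        using alg unfolding cemb_def by (metis add_cancel_left_left add_0)
      then show ?thesis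
        using hsq[rule_format, of "nat i"] by (auto simp: hx_def nat_le_iff)
    qed
    show "hx M h i = 0" if "i \<le> 0" for i
      using that by (simp add: hx_def)
    show "B (n + 1) * (1 + (hx M b (n - 4))\<^sup>2 * B (n - 3)) = B (n - 1) * (1 + (hx M b n)\<^sup>2 * B (n + 1))"
      if "even n" "6 \<le> n" "hx M h (n + 2) \<noteq> 0" for n
    proof -
      obtain m where m: "n = 2 * m"
        by (rule evenE[OF \<open>even n\<close>])
      define k where "k = nat (m - 3)"
      have n: "n = 2 * int k + 6"
        using that(2) m by (simp add: k_def)
      \<comment> \<open>h (n + 2) being nonzero forces n + 2 \<le> M, and n = 2 (k + 3).\<close>
      then have "2 * (k + 3) \<le> M"
        using that(3) by (simp add: hx_def split: if_splits)
      then have "betaden (hx M b) b3 b5 k \<noteq> 0"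
        using den by blast
      moreover have "nat ((n + 1 - 1) div 2) = k + 3" "nat ((n - 1 - 1) div 2) = k + 2"
        "nat ((n - 3 - 1) div 2) = k + 1" "n - 4 = 2 * int k + 2"
        using n by auto
      ultimately show ?thesis
        unfolding B_def using betaf_rec n by metis
    qed
  qed (fact hx_swap[OF hanti hcomm])+
  define r :: nat where "r = (if odd M then 1 else 2)"
  have peel_M: "peel (int M) = int (M - r)"
    using M1 by (auto simp: peel_def r_def of_nat_diff elim!: evenE)
  have chi_com: "com chi (hx M h i)" if "i \<le> peel (int M)" for i
  proof (cases "1 \<le> i")
    case True
    then obtain m where m: "i = int m" "1 \<le> m"
      by (metis nat_0_le of_nat_le_iff of_nat_1 order_trans zero_le_one)
    with that have "m < M - 1 \<or> odd M \<and> m < M" "m \<le> M"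
      unfolding peel_M using True by (auto simp: r_def split: if_splits)
    with chi_even chi_odd m show ?thesis
      by (cases "even M") (auto simp: com_def hx_def)
  qed (simp add: com_def hx_def)
  have chi_ant: "ant chi (hx M h (int M))"
    using chi_even chi_odd M1 by (cases "even M") (auto simp: ant_def hx_def)
  have V_eq: "V (int i) = Vset i" for i
  proof (rule vertex_set_eqI)
    show "(l, True) \<in> V (int i) \<longleftrightarrow> (l, True) \<in> Vset i" for l
    proof -
      have "(\<exists>m. l = 2 * m + 1 \<and> 2 \<le> m \<and> m \<le> int i div 2) \<longleftrightarrow> odd l \<and> 5 \<le> l \<and> l \<le> int i + 1"
        by presburger
      then show ?thesis by (auto simp: Vset_def)
    qed
  qed (auto simp: Vset_def)
  have val_eq: "val = vval c M h b b3 b5"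
  proof
    fix v :: "int \<times> bool"
    show "val v = vval c M h b b3 b5 v"
      by (cases v; cases "snd v") (auto simp: hb_def B_def)
  qed
  have Tm_eq: "Tm c M h b b3 b5 i v = t v (int i)" for i v
    using ipoly_by_card[OF finite_V, of v "int i"]
    by (simp add: Tm_def Qch_def V_eq val_eq)
  have Qch_eq: "Qch c M h b b3 b5 M 1 = ham (int M)"
    using ham_by_card[of "int M"] by (simp add: Qch_def V_eq val_eq)
  interpret edge_mode c "hx M h" "hx M b" B "int M" chi "P M" "P (M - r)"
  proof
    show "ant chi (clique (int M))"
    proof (cases "odd M")
      case True
      then show ?thesis
        using chi_ant by (simp add: clique_def)
    next
      case False
      then have "ant chi (hx M h (int M - 1))"
        using chi_even M1 by (auto simp: ant_def hx_def nat_diff_distrib)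
      \<comment> \<open>Of the factors h (M - 2), h (M - 3), h M only the last anticommutes with
        \<open>chi\<close>.\<close>
      moreover have "ant chi (hb (int M + 1))"
        unfolding hb_def mult.assoc using False chi_ant
        by (intro ant_mult_right com_rules chi_com) (auto simp: peel_def)
      ultimately show ?thesis
        using False chi_ant by (simp add: clique_def ant_rules)
    qed
    show "t v (int M) * t (- v) (int M) = c (poly (P M) (v\<^sup>2))" for v
      using Pdef by (simp add: Tm_eq)
    show "t v (peel (int M)) * t (- v) (peel (int M)) = c (poly (P (M - r)) (v\<^sup>2))" for v
      using Pdef[rule_format, of "M - r"] by (simp add: Tm_eq peel_M)
  qed (use chi_com chisq in auto)
  let ?S = "(M + 2) div 3"
  \<comment> \<open>From T(0) = 1; hence \<open>P M\<close> is nonzero and none of its roots is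
    zero.\<close>
  have P0: "poly (P M) 0 = 1"
    using norm[of 0] c_eq_iff[of "poly (P M) 0" 1] by (simp add: t_0)
  have deg: "degree (P M) \<le> ?S"
    using degree_t_norm[OF norm] by (simp add: nat_div_distrib nat_add_distrib)
  have simple: "poly (pderiv (P M)) (z k) \<noteq> 0" if "k \<in> {1..?S}" for k
  proof (rule poly_pderiv_nonzero_of_roots[where A = "z ` {1..?S}"])
    show "P M \<noteq> 0" using P0 by auto
    show "degree (P M) \<le> card (z ` {1..?S})"
      unfolding card_image[OF zdist] using deg by simp
  qed (use zroot that in auto)
  have Psi_eq: "Psi c M h b b3 b5 chi u N k = c (1 / N (nat \<bar>k\<bar>)) * C (us u k)" for k
    by (simp add: Psi_def C_def Tm_eq)
  show ?thesis
  proof (intro ballI conjI)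
    fix k k' :: int
    assume k: "k \<in> {k. k \<noteq> 0 \<and> \<bar>k\<bar> \<le> int ?S}" and k': "k' \<in> {k. k \<noteq> 0 \<and> \<bar>k\<bar> \<le> int ?S}"
    have ran: "nat \<bar>i\<bar> \<in> {1..?S}" if "i \<in> {k. k \<noteq> 0 \<and> \<bar>k\<bar> \<le> int ?S}" for i
      using that by auto
    have us_sq: "(us u i)\<^sup>2 = z (nat \<bar>i\<bar>)" if "i \<in> {k. k \<noteq> 0 \<and> \<bar>k\<bar> \<le> int ?S}" for i
      using usq[rule_format, OF ran[OF that]] that by (auto simp: us_def)
    have root: "poly (P M) ((us u i)\<^sup>2) = 0" if "i \<in> {k. k \<noteq> 0 \<and> \<bar>k\<bar> \<le> int ?S}" for i
      unfolding us_sq[OF that] using zroot ran[OF that] by blast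
    have nz: "us u k \<noteq> 0"
      using root[OF k] P0 by auto
    show "Qch c M h b b3 b5 M 1 * Psi c M h b b3 b5 chi u N k
        - Psi c M h b b3 b5 chi u N k * Qch c M h b b3 b5 M 1
        = c (2 * (1 / us u k)) * Psi c M h b b3 b5 chi u N k"
      unfolding Psi_eq Qch_eq using C_eigen[OF nz root[OF k]]
      by (simp add: ad_def c_left_comm[of "ham _"] c_left_comm[of "c (2 / us u k)"] mult.assoc
        flip: right_diff_distrib)
    \<comment> \<open>Equal squares force equal absolute values of the indices because the roots are
      distinct, and k' = k is excluded as \<open>us u k\<close> is nonzero.\<close>
    have "us u k' = - us u k \<longleftrightarrow> k + k' = 0"
    proof
      assume *: "us u k' = - us u k"
      then have "z (nat \<bar>k\<bar>) = z (nat \<bar>k'\<bar>)"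
        using us_sq[OF k] us_sq[OF k'] by simp
      then have "nat \<bar>k\<bar> = nat \<bar>k'\<bar>"
        using inj_onD[OF zdist] ran[OF k] ran[OF k'] by blast
      then have "k' = k \<or> k' = - k" by linarith
      with * nz show "k + k' = 0" by auto
    qed (use k in \<open>auto simp: us_def add_eq_0_iff\<close>)
    moreover have "16 * (poly (P (M - r)) ((us u k)\<^sup>2) * (- (us u k)\<^sup>2 * poly (pderiv (P M)) ((us u k)\<^sup>2)))
        = (N (nat \<bar>k\<bar>))\<^sup>2"
      using Nsq[rule_format, OF ran[OF k]] us_sq[OF k] usq[rule_format, OF ran[OF k]]
      by (simp add: r_def)
    ultimately have anti: "C (us u k) * C (us u k') + C (us u k') * C (us u k)
        = c (if k + k' = 0 then (N (nat \<bar>k\<bar>))\<^sup>2 else 0)"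
      using anticommutator_C[OF nz root[OF k] root[OF k']] by simp
    \<comment> \<open>Each factor of N^2 is nonzero: the value of the peeled polynomial by
      hypothesis, \<open>us u k\<close> as above, and the derivative because all roots are
      simple.\<close>
    have N: "N (nat \<bar>k\<bar>) \<noteq> 0"
    proof
      assume "N (nat \<bar>k\<bar>) = 0"
      then have "poly (P (M - r)) (z (nat \<bar>k\<bar>)) * ((us u k)\<^sup>2 * poly (pderiv (P M)) (z (nat \<bar>k\<bar>))) = 0"
        using Nsq[rule_format, OF ran[OF k]] usq[rule_format, OF ran[OF k]] us_sq[OF k]
        by (simp add: r_def)
      with simple[OF ran[OF k]] znz ran[OF k] nz show False
        by (auto simp: r_def)
    qed
    have "Psi c M h b b3 b5 chi u N k * Psi c M h b b3 b5 chi u N k'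
        + Psi c M h b b3 b5 chi u N k' * Psi c M h b b3 b5 chi u N k
        = c (1 / N (nat \<bar>k\<bar>) * (1 / N (nat \<bar>k'\<bar>))) *
          (C (us u k) * C (us u k') + C (us u k') * C (us u k))"
      unfolding Psi_eq by (rule anticommutator_scale)
    \<comment> \<open>For k' = -k both modes carry the same normalisation, whose square cancels the
      scalar in \<open>anti\<close>.\<close>
    also have "\<dots> = (if k + k' = 0 then 1 else 0)"
      using N by (auto simp: anti add_eq_0_iff power2_eq_square simp flip: c_mult)
    finally show "Psi c M h b b3 b5 chi u N k * Psi c M h b b3 b5 chi u N k'
        + Psi c M h b b3 b5 chi u N k' * Psi c M h b b3 b5 chi u N k
        = (if k + k' = 0 then 1 else 0)" .
  qed
qed

end
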